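(* Let $d\ge 1$, let $\mu_\beta$ be one of the Ising states on $\{+1,-1\}^{\mathbb{Z}^{d+1}}$ and let $\nu_\beta$ be its restriction to the layer $\Xi=\{x\in\mathbb{Z}^{d+1}:x_{d+1}=0\}$. Suppose that there are constants $C<\infty$, $m>0$ such that for all $x\in\mathbb{Z}^{d+1}$ $$\mu_\beta(X(0);X(x))\le C\exp(-2m|x|).$$ Then there is a set $K_0\subset\Omega=\{+1,-1\}^{\mathbb{Z}^d}$ with $\nu_\beta(K_0)=1$ such that for all $\xi\in K_0$ there is a length $\ell=\ell(0,\xi)<\infty$ for which $$|\mu_\beta^\xi(X(0,1);X(i,1))|\le C e^{-m|i|}$$ for every $i\in\mathbb{Z}^d$ with $|i|>\ell$.
   Context: Ising states: for finite $\Lambda\subset\mathbb{Z}^{d+1}$, $\beta\ge0$ and $h\in\mathbb{R}\setminus\{0\}$, $\mu^h_{\Lambda,\beta}$ is the probability measure on $\{+1,-1\}^\Lambda$ with weights proportional to $\exp[\beta\sum_{\langle xy\rangle\subset\Lambda}(\sigma_x\sigma_y-1)+h\sum_{x\in\Lambda}\sigma_x]$, the first sum being over nearest neighbour pairs in $\Lambda$; $\mu_\beta^h=\lim_{\Lambda\uparrow\mathbb{Z}^{d+1}}\mu^h_{\Lambda,\beta}$; $\mu_\beta^+=\lim_{h\downarrow0}\mu_\beta^h$ and $\mu_\beta^-=\lim_{h\uparrow0}\mu_\beta^h$ (weak limits). The Ising states are the measures $\mu_\beta^h$ ($h\ne0$), $\mu_\beta^+$ and $\mu_\beta^-$; $\mu_\beta$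 denotes any one of them, and $X=(X(x),x\in\mathbb{Z}^{d+1})$ is the corresponding random field. The layer $\Xi$ is identified with $\mathbb{Z}^d$ via $i\leftrightarrow(i,0)$; $\nu_\beta$ is the law on $\Omega=\{+1,-1\}^{\mathbb{Z}^d}$ of $(X((i,0)))_{i\in\mathbb{Z}^d}$ under $\mu_\beta$. $X(i,1)$ is the spin at the site $(i,1)\in\mathbb{Z}^d\times\mathbb{Z}$. For $\nu_\beta$-almost every $\xi\in\Omega$, $\mu_\beta^\xi$ is the (regular) conditional distribution of $X$ under $\mu_\beta$ given that $X((i,0))=\xi_i$ for all $i\in\mathbb{Z}^d$. For a measure $\mu$, $\mu(f;g)=\mu(fg)-\mu(f)\mu(g)$ denotes the covariance; $|x|=\sum_k|x_k|$. *)

theory Defs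
  imports "HOL-Probability.Probability"
begin

text \<open>
  The lattice \<open>\<int>\<^sup>d\<close> is \<open>int ^ 'd\<close> for a finite (hence nonempty) index type \<open>'d\<close>, so
  \<open>d = CARD('d) \<ge> 1\<close> is arbitrary, and \<open>\<int>\<^bsup>d+1\<^esup>\<close> is \<open>\<int>\<^sup>d \<times> \<int>\<close>.
  The layer \<open>\<Xi>\<close> consists of the sites \<open>(i, 0)\<close>.
\<close>

type_synonym 'd site = "(int ^ 'd) \<times> int"

definition layer_norm :: "int ^ 'd::finite \<Rightarrow> int" where
  "layer_norm i = (\<Sum>k\<in>UNIV. \<bar>i $ k\<bar>)"

definition site_norm :: "'d::finite site \<Rightarrow> int" where
  "site_norm x = layer_norm (fst x) + \<bar>snd x\<bar>"

definition spin_configs :: "'s set \<Rightarrow> ('s \<Rightarrow> real) set" where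
  "spin_configs S = (\<Pi>\<^sub>E x\<in>S. {-1, 1})"

definition spin_space :: "('s \<Rightarrow> real) measure" where
  "spin_space = (\<Pi>\<^sub>M x\<in>UNIV. count_space {-1, 1})"

definition cov :: "'a measure \<Rightarrow> ('a \<Rightarrow> real) \<Rightarrow> ('a \<Rightarrow> real) \<Rightarrow> real" where
  "cov M f g = (\<integral>\<omega>. f \<omega> * g \<omega> \<partial>M) - (\<integral>\<omega>. f \<omega> \<partial>M) * (\<integral>\<omega>. g \<omega> \<partial>M)"

subsection \<open>Finite volume\<close>

definition nn_pairs :: "'d::finite site set \<Rightarrow> 'd site set set" where
  "nn_pairs \<Lambda> = {{x, y} |x y. x \<in> \<Lambda> \<and> y \<in> \<Lambda> \<and> site_norm (x - y) = 1}"

text \<open>Each \<open>e = {x, y}\<close> in \<open>nn_pairs \<Lambda>\<close> has two elements, so the product over \<open>e\<close> is \<open>\<sigma> x * \<sigma> y\<close>.\<close>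

definition ising_weight :: "real \<Rightarrow> real \<Rightarrow> 'd::finite site set \<Rightarrow> ('d site \<Rightarrow> real) \<Rightarrow> real" where
  "ising_weight \<beta> h \<Lambda> \<sigma> =
     exp (\<beta> * (\<Sum>e\<in>nn_pairs \<Lambda>. (\<Prod>x\<in>e. \<sigma> x) - 1) + h * (\<Sum>x\<in>\<Lambda>. \<sigma> x))"

definition ising_finite :: "real \<Rightarrow> real \<Rightarrow> 'd::finite site set \<Rightarrow> ('d site \<Rightarrow> real) measure" where
  "ising_finite \<beta> h \<Lambda> = point_measure (spin_configs \<Lambda>)
     (\<lambda>\<sigma>. ennreal (ising_weight \<beta> h \<Lambda> \<sigma> / (\<Sum>\<tau>\<in>spin_configs \<Lambda>. ising_weight \<beta> h \<Lambda> \<tau>)))"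

text \<open>
  To speak of weak convergence as \<open>\<Lambda>\<close> varies, a measure on \<open>{-1, 1}\<^bsup>\<Lambda>\<^esup>\<close> is regarded as a measure
  on the full configuration space by extending configurations by \<open>1\<close> outside \<open>\<Lambda>\<close>. The choice of
  extension does not affect the limit, since every finite set of sites eventually lies in \<open>\<Lambda>\<close>;
  in particular the spins outside \<open>\<Lambda>\<close> are not a boundary condition.
\<close>

definition extend_spins :: "'s set \<Rightarrow> ('s \<Rightarrow> real) \<Rightarrow> 's \<Rightarrow> real" where
  "extend_spins \<Lambda> \<sigma> = (\<lambda>x. if x \<in> \<Lambda> then \<sigma> x else 1)"

definition ising_finite_ext :: "real \<Rightarrow> real \<Rightarrow> 'd::finite site set \<Rightarrow> ('d site \<Rightarrow> real) measure" where
  "ising_finite_ext \<beta> h \<Lambda> = distr (ising_finite \<beta> h \<Lambda>) spin_space (extend_spins \<Lambda>)"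

subsection \<open>Weak limits and Ising states\<close>

text \<open>
  The topology is the product topology on \<open>'s \<Rightarrow> real\<close>, which on \<open>spin_configs UNIV\<close> is the
  product of the discrete topologies on \<open>{-1, 1}\<close>. That space is compact, so the continuous test
  functions are bounded.
\<close>

definition weak_limit ::
  "('a \<Rightarrow> ('s \<Rightarrow> real) measure) \<Rightarrow> ('s \<Rightarrow> real) measure \<Rightarrow> 'a filter \<Rightarrow> bool" where
  "weak_limit N \<mu> F \<longleftrightarrow>
     prob_space \<mu> \<and> sets \<mu> = sets spin_space \<and>
     (\<forall>f :: ('s \<Rightarrow> real) \<Rightarrow> real. continuous_on (spin_configs UNIV) f \<longrightarrow>
        ((\<lambda>a. \<integral>\<sigma>. f \<sigma> \<partial>N a) \<longlongrightarrow> (\<integral>\<sigma>. f \<sigma> \<partial>\<mu>)) F)"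

definition ising_field_state :: "real \<Rightarrow> real \<Rightarrow> ('d::finite site \<Rightarrow> real) measure \<Rightarrow> bool" where
  "ising_field_state \<beta> h \<mu> \<longleftrightarrow> weak_limit (ising_finite_ext \<beta> h) \<mu> (finite_subsets_at_top UNIV)"

definition ising_plus_state :: "real \<Rightarrow> ('d::finite site \<Rightarrow> real) measure \<Rightarrow> bool" where
  "ising_plus_state \<beta> \<mu> \<longleftrightarrow>
     (\<exists>M. (\<forall>h>0. ising_field_state \<beta> h (M h)) \<and> weak_limit M \<mu> (at_right 0))"

definition ising_minus_state :: "real \<Rightarrow> ('d::finite site \<Rightarrow> real) measure \<Rightarrow> bool" where
  "ising_minus_state \<beta> \<mu> \<longleftrightarrow>
     (\<exists>M. (\<forall>h<0. ising_field_state \<beta> h (M h)) \<and> weak_limit M \<mu> (at_left 0))"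

definition ising_state :: "real \<Rightarrow> ('d::finite site \<Rightarrow> real) measure \<Rightarrow> bool" where
  "ising_state \<beta> \<mu> \<longleftrightarrow>
     (\<exists>h. h \<noteq> 0 \<and> ising_field_state \<beta> h \<mu>) \<or> ising_plus_state \<beta> \<mu> \<or> ising_minus_state \<beta> \<mu>"

subsection \<open>The layer\<close>

definition to_layer :: "('d::finite site \<Rightarrow> real) \<Rightarrow> int ^ 'd \<Rightarrow> real" where
  "to_layer \<sigma> = (\<lambda>i. \<sigma> (i, 0))"

definition layer_law :: "('d::finite site \<Rightarrow> real) measure \<Rightarrow> (int ^ 'd \<Rightarrow> real) measure" where
  "layer_law \<mu> = distr \<mu> spin_space to_layer"

text \<open>
  \<open>layer_cond_dist \<mu> \<kappa>\<close> says that \<open>\<kappa>\<close> is a version of the regular conditional distribution under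
  \<open>\<mu>\<close> of the whole field given its values on the layer. Versions agree up to \<open>layer_law \<mu>\<close>-null
  sets, so \<open>\<kappa>\<close> being defined on all layer configurations is no restriction.
\<close>

definition layer_cond_dist ::
  "('d::finite site \<Rightarrow> real) measure \<Rightarrow> ((int ^ 'd \<Rightarrow> real) \<Rightarrow> ('d site \<Rightarrow> real) measure) \<Rightarrow> bool" where
  "layer_cond_dist \<mu> \<kappa> \<longleftrightarrow>
     \<kappa> \<in> spin_space \<rightarrow>\<^sub>M prob_algebra spin_space \<and>
     (\<forall>A\<in>sets spin_space. \<forall>B\<in>sets spin_space.
        emeasure \<mu> {\<sigma>\<in>A. to_layer \<sigma> \<in> B} = (\<integral>\<^sup>+\<xi>\<in>B. emeasure (\<kappa> \<xi>) A \<partial>layer_law \<mu>))"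

end

theory Submission
  imports Defs
begin

text \<open>
  Write \<open>\<nu>\<close> for the law of the layer. Conditionally on the layer, the spins at \<open>(0, 1)\<close> and \<open>(i, 1)\<close>
  are nonnegatively correlated, and the \<open>\<nu>\<close>-average of their conditional covariance is at most their
  unconditional covariance. By translation invariance the latter is the covariance of the spins at
  \<open>0\<close> and \<open>(i, 0)\<close>, hence at most \<open>C * exp (- 2 * m * \<bar>i\<bar>)\<close>. Markov's inequality then bounds the
  \<open>\<nu>\<close>-probability that the conditional covariance exceeds \<open>C * exp (- m * \<bar>i\<bar>)\<close> by
  \<open>exp (- m * \<bar>i\<bar>)\<close>; these bounds are summable over the lattice, and the Borel-Cantelli lemma
  leaves, for almost every layer configuration, only finitely many exceptional \<open>i\<close>.

  The two statements about conditional covariances (\<open>conditional_spin_covariance\<close>) are forms of the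
  FKG inequality. By the law of total covariance, the unconditional covariance minus the average of
  the conditional one is the covariance of the two conditional expectations, and these are increasing
  functions of the layer configuration.

  Both are derived from the four functions theorem of Ahlswede and Daykin. It compares integrals of
  four functions, so for continuous functions it passes from the finite volume measures to their weak
  limits, and every Ising state satisfies it (\<open>four_functions_ising_state\<close>). This takes the place of
  a description of the conditional distributions as Gibbs measures. Conditioning on the spins in a
  finite set \<open>T\<close> of layer sites amounts to multiplying the four functions by indicators of atoms,
  i.e. of the events fixing all spins in \<open>T\<close>; a suitable choice of the four functions gives
  nonnegative conditional correlations, monotonicity of conditional expectations and the lattice
  condition for the layer. To pass from finite \<open>T\<close> to the whole layer, a conditional expectation is
  approximated in \<open>L\<^sup>1\<close> by a function of finitely many layer spins
  (\<open>cylinder_approximable_integrable\<close>, \<open>sum_integral_atom_product_error\<close>).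
\<close>

section \<open>The four functions theorem on finite spin configurations\<close>

text \<open>
  The case of a single spin. With \<open>s = c1 * d0\<close>, both mixed products \<open>x = a0 * b1\<close> and
  \<open>y = a1 * b0\<close> are at most \<open>s\<close>, while \<open>x * y \<le> s * (c0 * d1)\<close>. Expanding \<open>(s - x) * (s - y) \<ge> 0\<close>
  turns this into \<open>x + y \<le> s + c0 * d1\<close>, the only part of the claim that does not hold termwise.
\<close>

lemma four_functions_two_point:
  fixes a0 a1 b0 b1 c0 c1 d0 d1 :: real
  assumes nonneg: "0 \<le> a0" "0 \<le> a1" "0 \<le> b0" "0 \<le> b1" "0 \<le> c0" "0 \<le> c1" "0 \<le> d0" "0 \<le> d1"
    and 00: "a0 * b0 \<le> c0 * d0" and 01: "a0 * b1 \<le> c1 * d0"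
    and 10: "a1 * b0 \<le> c1 * d0" and 11: "a1 * b1 \<le> c1 * d1"
  shows "(a0 + a1) * (b0 + b1) \<le> (c0 + c1) * (d0 + d1)"
proof (cases "c1 * d0 = 0")
  case True
  then have "a0 * b1 = 0" "a1 * b0 = 0"
    using 01 10 nonneg by (metis antisym mult_nonneg_nonneg)+
  then have "(a0 + a1) * (b0 + b1) = a0 * b0 + a1 * b1"
    by (simp only: distrib_left distrib_right)
  also have "\<dots> \<le> c0 * d0 + c1 * d1"
    using 00 11 by simp
  also have "\<dots> \<le> (c0 + c1) * (d0 + d1)"
    using nonneg by (simp add: algebra_simps)
  finally show ?thesis .
next
  case False
  define s where "s = c1 * d0"
  have s: "s > 0"
    using False nonneg by (simp add: s_def order_less_le)
  have "0 \<le> (s - a0 * b1) * (s - a1 * b0)"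
    using 01 10 by (simp add: s_def)
  also have "\<dots> = s * s + (a0 * b0) * (a1 * b1) - s * (a0 * b1 + a1 * b0)"
    by (simp add: algebra_simps)
  also have "(a0 * b0) * (a1 * b1) \<le> (c0 * d0) * (c1 * d1)"
    using 00 11 nonneg by (intro mult_mono[of "a0 * b0" "c0 * d0"]) auto
  finally have "s * (a0 * b1 + a1 * b0) \<le> s * (s + c0 * d1)"
    by (simp add: s_def algebra_simps)
  then have "a0 * b1 + a1 * b0 \<le> s + c0 * d1"
    using s by simp
  then show ?thesis
    using 00 11 by (simp add: s_def algebra_simps)
qed

lemma sum_spin_configs_insert:
  assumes "finite S" and "x \<notin> S"
  shows "(\<Sum>\<sigma>\<in>spin_configs (insert x S). f \<sigma>)
    = (\<Sum>\<sigma>\<in>spin_configs S. f (\<sigma>(x := -1)) + f (\<sigma>(x := 1)))"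
proof -
  have "(\<Sum>\<sigma>\<in>spin_configs (insert x S). f \<sigma>)
      = (\<Sum>(y, \<sigma>)\<in>{-1, 1} \<times> spin_configs S. f (\<sigma>(x := y)))"
    unfolding spin_configs_def PiE_insert_eq
    by (subst sum.reindex) (use inj_combinator[OF assms(2)] in \<open>auto simp: case_prod_beta\<close>)
  also have "\<dots> = (\<Sum>y\<in>{-1, 1}. \<Sum>\<sigma>\<in>spin_configs S. f (\<sigma>(x := y)))"
    by (simp add: sum.cartesian_product)
  finally show ?thesis
    by (simp add: sum.distrib)
qed

lemma sup_inf_fun_upd:
  fixes \<sigma> \<tau> :: "'s \<Rightarrow> real"
  shows "sup (\<sigma>(x := s)) (\<tau>(x := t)) = (sup \<sigma> \<tau>)(x := max s t)"
    and "inf (\<sigma>(x := s)) (\<tau>(x := t)) = (inf \<sigma> \<tau>)(x := min s t)"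
  by (auto simp: fun_eq_iff sup_real_def inf_real_def)

lemma spin_configs_upd:
  "\<sigma> \<in> spin_configs S \<Longrightarrow> s \<in> {-1, 1} \<Longrightarrow> \<sigma>(x := s) \<in> spin_configs (insert x S)"
  unfolding spin_configs_def by (rule PiE_fun_upd)

lemma spin_configs_sup_inf:
  assumes "\<sigma> \<in> spin_configs S" and "\<tau> \<in> spin_configs S"
  shows "sup \<sigma> \<tau> \<in> spin_configs S" and "inf \<sigma> \<tau> \<in> spin_configs S"
proof -
  have *: "\<sigma> x = -1 \<or> \<sigma> x = 1" "\<tau> x = -1 \<or> \<tau> x = 1" if "x \<in> S" for x
    using assms that by (auto simp: spin_configs_def PiE_iff)
  have **: "\<sigma> x = undefined" "\<tau> x = undefined" if "x \<notin> S" for x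
    using assms that by (auto simp: spin_configs_def PiE_iff extensional_def)
  show "sup \<sigma> \<tau> \<in> spin_configs S"
    unfolding spin_configs_def
  proof (rule PiE_I)
    show "sup \<sigma> \<tau> x \<in> {-1, 1}" if "x \<in> S" for x
      using *[OF that] by (auto simp: sup_real_def)
  qed (use ** in auto)
  show "inf \<sigma> \<tau> \<in> spin_configs S"
    unfolding spin_configs_def
  proof (rule PiE_I)
    show "inf \<sigma> \<tau> x \<in> {-1, 1}" if "x \<in> S" for x
      using *[OF that] by (auto simp: inf_real_def)
  qed (use ** in auto)
qed

text \<open>
  The four functions theorem of Ahlswede and Daykin on \<open>{-1, 1}\<^bsup>S\<^esup>\<close>. Summing each function over the
  spin at one site \<open>x\<close> preserves the hypothesis, by the case of a single spin, so \<open>x\<close> can be removed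
  from \<open>S\<close>.
\<close>

theorem four_functions_spin_configs:
  fixes f1 f2 f3 f4 :: "('s \<Rightarrow> real) \<Rightarrow> real"
  assumes "finite S"
    and "\<And>\<sigma>. \<sigma> \<in> spin_configs S \<Longrightarrow> 0 \<le> f1 \<sigma> \<and> 0 \<le> f2 \<sigma> \<and> 0 \<le> f3 \<sigma> \<and> 0 \<le> f4 \<sigma>"
    and "\<And>\<sigma> \<tau>. \<sigma> \<in> spin_configs S \<Longrightarrow> \<tau> \<in> spin_configs S \<Longrightarrow>
           f1 \<sigma> * f2 \<tau> \<le> f3 (sup \<sigma> \<tau>) * f4 (inf \<sigma> \<tau>)"
  shows "(\<Sum>\<sigma>\<in>spin_configs S. f1 \<sigma>) * (\<Sum>\<sigma>\<in>spin_configs S. f2 \<sigma>)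
       \<le> (\<Sum>\<sigma>\<in>spin_configs S. f3 \<sigma>) * (\<Sum>\<sigma>\<in>spin_configs S. f4 \<sigma>)"
  using assms
proof (induction S arbitrary: f1 f2 f3 f4 rule: finite_induct)
  case empty
  from empty(2)[of "\<lambda>_. undefined" "\<lambda>_. undefined"] show ?case
    by (simp add: spin_configs_def sup_fun_def inf_fun_def)
next
  case (insert x S)
  note lattice = insert.prems(2)[OF spin_configs_upd spin_configs_upd, unfolded sup_inf_fun_upd]
  have nonneg: "0 \<le> f1 (\<sigma>(x := s))" "0 \<le> f2 (\<sigma>(x := s))" "0 \<le> f3 (\<sigma>(x := s))" "0 \<le> f4 (\<sigma>(x := s))"
    if "\<sigma> \<in> spin_configs S" "s \<in> {-1, 1}" for \<sigma> s
    using insert.prems(1)[OF spin_configs_upd[OF that]] by blast+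
  have minmax: "max (-1) 1 = (1::real)" "max 1 (-1) = (1::real)" "min (-1) 1 = (-1::real)" "min 1 (-1) = (-1::real)"
    by auto
  show ?case
    unfolding sum_spin_configs_insert[OF insert.hyps]
  proof (rule insert.IH)
    fix \<sigma> \<tau> assume \<sigma>: "\<sigma> \<in> spin_configs S" and \<tau>: "\<tau> \<in> spin_configs S"
    note st = spin_configs_sup_inf[OF \<sigma> \<tau>]
    show "(f1 (\<sigma>(x := -1)) + f1 (\<sigma>(x := 1))) * (f2 (\<tau>(x := -1)) + f2 (\<tau>(x := 1)))
      \<le> (f3 ((sup \<sigma> \<tau>)(x := -1)) + f3 ((sup \<sigma> \<tau>)(x := 1)))
        * (f4 ((inf \<sigma> \<tau>)(x := -1)) + f4 ((inf \<sigma> \<tau>)(x := 1)))"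
      by (intro four_functions_two_point
          lattice[OF \<sigma> _ \<tau>, of "-1" "-1", unfolded min.idem max.idem]
          lattice[OF \<sigma> _ \<tau>, of "-1" 1, unfolded minmax] lattice[OF \<sigma> _ \<tau>, of 1 "-1", unfolded minmax]
          lattice[OF \<sigma> _ \<tau>, of 1 1, unfolded min.idem max.idem] nonneg[OF \<sigma>] nonneg[OF \<tau>] nonneg[OF st(1)] nonneg[OF st(2)])
         simp_all
  qed (intro conjI add_nonneg_nonneg nonneg; simp)
qed

section \<open>Observables\<close>

lemma space_spin_space: "space spin_space = spin_configs UNIV"
  by (simp add: spin_space_def spin_configs_def space_PiM)

lemma spin_configs_UNIV_cases:
  assumes "\<sigma> \<in> spin_configs UNIV"
  shows "\<sigma> x = -1 \<or> \<sigma> x = 1"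
  using assms by (auto simp: spin_configs_def PiE_iff)

lemma spin_measurable [measurable]: "(\<lambda>\<sigma>. \<sigma> x) \<in> borel_measurable spin_space"
proof -
  have "(\<lambda>\<sigma>. \<sigma> x) \<in> spin_space \<rightarrow>\<^sub>M count_space {-1, 1}"
    unfolding spin_space_def by (rule measurable_component_singleton) simp
  from measurable_compose[OF this, of "\<lambda>y. y" borel] show ?thesis
    by simp
qed

lemma finite_spin_configs: "finite S \<Longrightarrow> finite (spin_configs S)"
  unfolding spin_configs_def by (rule finite_PiE) auto

text \<open>
  The test functions whose integrals converge under \<open>weak_limit\<close>. Measurability is required
  separately because it is needed to compute integrals with respect to image measures.
\<close>

definition observable :: "(('s \<Rightarrow> real) \<Rightarrow> real) \<Rightarrow> bool" where
  "observable f \<longleftrightarrow> f \<in> borel_measurable spin_space \<and> continuous_on (spin_configs UNIV) f"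

lemma observable_const: "observable (\<lambda>_. c)"
  by (simp add: observable_def)

lemma observable_spin: "observable (\<lambda>\<sigma>. \<sigma> x)"
  by (auto simp: observable_def intro: continuous_on_subset[OF continuous_on_product_coordinates])

lemma observable_mult: "observable f \<Longrightarrow> observable g \<Longrightarrow> observable (\<lambda>\<sigma>. f \<sigma> * g \<sigma>)"
  by (auto simp: observable_def intro: continuous_on_mult)

lemma observable_compose:
  assumes "observable f"
    and measurable: "\<theta> \<in> spin_space \<rightarrow>\<^sub>M spin_space"
    and "\<And>x. \<exists>y. \<forall>\<sigma>. \<theta> \<sigma> x = \<sigma> y"
  shows "observable (\<lambda>\<sigma>. f (\<theta> \<sigma>))"
  unfolding observable_def
proof
  show "(\<lambda>\<sigma>. f (\<theta> \<sigma>)) \<in> borel_measurable spin_space"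
    using assms(1) measurable_compose[OF measurable] by (auto simp: observable_def)
  have "continuous_on (spin_configs UNIV) (\<lambda>\<sigma>. \<theta> \<sigma> x)" for x
  proof -
    from assms(3) obtain y where "\<And>\<sigma>. \<theta> \<sigma> x = \<sigma> y"
      by blast
    then show ?thesis
      by (simp add: continuous_on_subset[OF continuous_on_product_coordinates])
  qed
  then have "continuous_on (spin_configs UNIV) \<theta>"
    by (rule continuous_on_coordinatewise_then_product)
  moreover have "\<theta> ` spin_configs UNIV \<subseteq> spin_configs UNIV"
    using measurable_space[OF measurable] by (auto simp: space_spin_space)
  ultimately show "continuous_on (spin_configs UNIV) (\<lambda>\<sigma>. f (\<theta> \<sigma>))"
    using assms(1) continuous_on_compose2[of "spin_configs UNIV" f "spin_configs UNIV" \<theta>]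
    by (simp add: observable_def)
qed

lemma reindex_spins_measurable: "(\<lambda>\<sigma> x. \<sigma> (g x)) \<in> spin_space \<rightarrow>\<^sub>M spin_space"
  unfolding spin_space_def
  by (rule measurable_PiM_single')
     (auto intro!: measurable_component_singleton simp: space_PiM PiE_iff)

lemma observable_reindex: "observable f \<Longrightarrow> observable (\<lambda>\<sigma>. f (\<lambda>x. \<sigma> (g x)))"
  by (rule observable_compose[OF _ reindex_spins_measurable]) auto

section \<open>The four functions theorem for Ising states\<close>

text \<open>
  The ferromagnetic interaction enters here: replacing two spin pairs by their pointwise maximum and
  minimum can only increase the sum of the two products. The field term is linear and does not
  change.
\<close>

lemma ising_weight_log_supermodular:
  fixes \<sigma> \<tau> :: "'d::finite site \<Rightarrow> real"
  assumes "\<beta> \<ge> 0" and \<sigma>: "\<sigma> \<in> spin_configs \<Lambda>" and \<tau>: "\<tau> \<in> spin_configs \<Lambda>"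
  shows "ising_weight \<beta> h \<Lambda> \<sigma> * ising_weight \<beta> h \<Lambda> \<tau>
    \<le> ising_weight \<beta> h \<Lambda> (sup \<sigma> \<tau>) * ising_weight \<beta> h \<Lambda> (inf \<sigma> \<tau>)"
proof -
  have spin: "\<sigma> x = -1 \<or> \<sigma> x = 1" "\<tau> x = -1 \<or> \<tau> x = 1" if "x \<in> \<Lambda>" for x
    using \<sigma> \<tau> that by (auto simp: spin_configs_def PiE_iff)
  define E where "E = (\<lambda>\<rho> :: 'd site \<Rightarrow> real. \<Sum>e\<in>nn_pairs \<Lambda>. (\<Prod>x\<in>e. \<rho> x) - 1)"
  define H where "H = (\<lambda>\<rho> :: 'd site \<Rightarrow> real. \<Sum>x\<in>\<Lambda>. \<rho> x)"
  have W: "ising_weight \<beta> h \<Lambda> \<rho> = exp (\<beta> * E \<rho> + h * H \<rho>)" for \<rho>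
    by (simp add: ising_weight_def E_def H_def)
  have "(\<Prod>x\<in>e. \<sigma> x) - 1 + ((\<Prod>x\<in>e. \<tau> x) - 1)
      \<le> (\<Prod>x\<in>e. sup \<sigma> \<tau> x) - 1 + ((\<Prod>x\<in>e. inf \<sigma> \<tau> x) - 1)"
    if "e \<in> nn_pairs \<Lambda>" for e
  proof -
    from that obtain x y where e: "e = {x, y}" "x \<in> \<Lambda>" "y \<in> \<Lambda>" "site_norm (x - y) = 1"
      by (auto simp: nn_pairs_def)
    then have "x \<noteq> y"
      by (auto simp: site_norm_def layer_norm_def)
    then show ?thesis
      using spin[OF e(2)] spin[OF e(3)] by (auto simp: e(1) sup_real_def inf_real_def)
  qed
  then have E: "E \<sigma> + E \<tau> \<le> E (sup \<sigma> \<tau>) + E (inf \<sigma> \<tau>)"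
    unfolding E_def sum.distrib[symmetric] by (rule sum_mono)
  have H: "H \<sigma> + H \<tau> = H (sup \<sigma> \<tau>) + H (inf \<sigma> \<tau>)"
    unfolding H_def sum.distrib[symmetric] by (rule sum.cong) (auto simp: sup_real_def inf_real_def)
  have "\<beta> * E \<sigma> + h * H \<sigma> + (\<beta> * E \<tau> + h * H \<tau>) = \<beta> * (E \<sigma> + E \<tau>) + h * (H \<sigma> + H \<tau>)"
    by (simp add: algebra_simps)
  also have "\<dots> \<le> \<beta> * (E (sup \<sigma> \<tau>) + E (inf \<sigma> \<tau>)) + h * (H (sup \<sigma> \<tau>) + H (inf \<sigma> \<tau>))"
    unfolding H by (intro add_right_mono mult_left_mono E \<open>\<beta> \<ge> 0\<close>)
  finally have "\<beta> * E \<sigma> + h * H \<sigma> + (\<beta> * E \<tau> + h * H \<tau>)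
      \<le> \<beta> * E (sup \<sigma> \<tau>) + h * H (sup \<sigma> \<tau>) + (\<beta> * E (inf \<sigma> \<tau>) + h * H (inf \<sigma> \<tau>))"
    by (simp add: distrib_left add_ac)
  then show ?thesis
    by (simp only: W exp_add[symmetric] exp_le_cancel_iff)
qed

lemma extend_spins_in_configs: "\<sigma> \<in> spin_configs \<Lambda> \<Longrightarrow> extend_spins \<Lambda> \<sigma> \<in> spin_configs UNIV"
  by (auto simp: spin_configs_def extend_spins_def PiE_iff)

lemma integral_ising_finite_ext:
  fixes \<Lambda> :: "'d::finite site set"
  assumes "finite \<Lambda>" and f: "f \<in> borel_measurable spin_space"
  shows "(\<integral>\<sigma>. f \<sigma> \<partial>ising_finite_ext \<beta> h \<Lambda>)
    = (\<Sum>\<sigma>\<in>spin_configs \<Lambda>. ising_weight \<beta> h \<Lambda> \<sigma> * f (extend_spins \<Lambda> \<sigma>))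
      / (\<Sum>\<sigma>\<in>spin_configs \<Lambda>. ising_weight \<beta> h \<Lambda> \<sigma>)"
proof -
  have "extend_spins \<Lambda> \<in> ising_finite \<beta> h \<Lambda> \<rightarrow>\<^sub>M spin_space"
    unfolding ising_finite_def measurable_point_measure_eq1
    using extend_spins_in_configs by (auto simp: space_spin_space)
  then have "(\<integral>\<sigma>. f \<sigma> \<partial>ising_finite_ext \<beta> h \<Lambda>) = (\<integral>\<sigma>. f (extend_spins \<Lambda> \<sigma>) \<partial>ising_finite \<beta> h \<Lambda>)"
    unfolding ising_finite_ext_def by (rule integral_distr[OF _ f])
  also have "\<dots> = (\<Sum>\<sigma>\<in>spin_configs \<Lambda>. ising_weight \<beta> h \<Lambda> \<sigma>
      / (\<Sum>\<tau>\<in>spin_configs \<Lambda>. ising_weight \<beta> h \<Lambda> \<tau>) * f (extend_spins \<Lambda> \<sigma>))"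
    unfolding ising_finite_def
    by (subst lebesgue_integral_point_measure_finite)
       (auto simp: finite_spin_configs[OF assms(1)] ising_weight_def intro!: divide_nonneg_nonneg sum_nonneg)
  finally show ?thesis
    by (simp add: sum_divide_distrib)
qed

lemma extend_spins_sup_inf:
  "extend_spins \<Lambda> (sup \<sigma> \<tau>) = sup (extend_spins \<Lambda> \<sigma>) (extend_spins \<Lambda> \<tau>)"
  "extend_spins \<Lambda> (inf \<sigma> \<tau>) = inf (extend_spins \<Lambda> \<sigma>) (extend_spins \<Lambda> \<tau>)"
  by (auto simp: extend_spins_def fun_eq_iff)

text \<open>
  Only continuous functions are compared, so that the condition is closed under weak limits.
\<close>

definition four_functions_measure :: "('s \<Rightarrow> real) measure \<Rightarrow> bool" where
  "four_functions_measure \<mu> \<longleftrightarrow> (\<forall>f1 f2 f3 f4.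
     observable f1 \<and> observable f2 \<and> observable f3 \<and> observable f4 \<and>
     (\<forall>\<sigma>\<in>spin_configs UNIV. 0 \<le> f1 \<sigma> \<and> 0 \<le> f2 \<sigma> \<and> 0 \<le> f3 \<sigma> \<and> 0 \<le> f4 \<sigma>) \<and>
     (\<forall>\<sigma>\<in>spin_configs UNIV. \<forall>\<tau>\<in>spin_configs UNIV. f1 \<sigma> * f2 \<tau> \<le> f3 (sup \<sigma> \<tau>) * f4 (inf \<sigma> \<tau>))
     \<longrightarrow> (\<integral>\<sigma>. f1 \<sigma> \<partial>\<mu>) * (\<integral>\<sigma>. f2 \<sigma> \<partial>\<mu>) \<le> (\<integral>\<sigma>. f3 \<sigma> \<partial>\<mu>) * (\<integral>\<sigma>. f4 \<sigma> \<partial>\<mu>))"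

text \<open>
  The Boltzmann weight is absorbed into the four functions; by log-supermodularity the products
  still satisfy the hypothesis of the finite theorem.
\<close>

lemma four_functions_ising_finite:
  fixes \<Lambda> :: "'d::finite site set"
  assumes "\<beta> \<ge> 0" and "finite \<Lambda>"
  shows "four_functions_measure (ising_finite_ext \<beta> h \<Lambda>)"
  unfolding four_functions_measure_def
proof (intro allI impI, elim conjE)
  fix f1 f2 f3 f4 :: "('d site \<Rightarrow> real) \<Rightarrow> real"
  assume obs: "observable f1" "observable f2" "observable f3" "observable f4"
    and nonneg: "\<forall>\<sigma>\<in>spin_configs UNIV. 0 \<le> f1 \<sigma> \<and> 0 \<le> f2 \<sigma> \<and> 0 \<le> f3 \<sigma> \<and> 0 \<le> f4 \<sigma>"
    and le: "\<forall>\<sigma>\<in>spin_configs UNIV. \<forall>\<tau>\<in>spin_configs UNIV. f1 \<sigma> * f2 \<tau> \<le> f3 (sup \<sigma> \<tau>) * f4 (inf \<sigma> \<tau>)"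
  define W where "W = ising_weight \<beta> h \<Lambda>"
  define Z where "Z = (\<Sum>\<sigma>\<in>spin_configs \<Lambda>. W \<sigma>)"
  define g where "g = (\<lambda>f \<sigma>. W \<sigma> * f (extend_spins \<Lambda> \<sigma>) :: real)"
  have W: "0 \<le> W \<sigma>" for \<sigma>
    by (simp add: W_def ising_weight_def)
  have integral: "(\<integral>\<sigma>. f \<sigma> \<partial>ising_finite_ext \<beta> h \<Lambda>) = (\<Sum>\<sigma>\<in>spin_configs \<Lambda>. g f \<sigma>) / Z"
    if "observable f" for f
    unfolding g_def Z_def W_def
    using that \<open>finite \<Lambda>\<close> by (intro integral_ising_finite_ext) (auto simp: observable_def)
  have "(\<Sum>\<sigma>\<in>spin_configs \<Lambda>. g f1 \<sigma>) * (\<Sum>\<sigma>\<in>spin_configs \<Lambda>. g f2 \<sigma>)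
      \<le> (\<Sum>\<sigma>\<in>spin_configs \<Lambda>. g f3 \<sigma>) * (\<Sum>\<sigma>\<in>spin_configs \<Lambda>. g f4 \<sigma>)"
  proof (rule four_functions_spin_configs[OF \<open>finite \<Lambda>\<close>])
    fix \<sigma> \<tau> assume \<sigma>: "\<sigma> \<in> spin_configs \<Lambda>" and \<tau>: "\<tau> \<in> spin_configs \<Lambda>"
    have "(W \<sigma> * W \<tau>) * (f1 (extend_spins \<Lambda> \<sigma>) * f2 (extend_spins \<Lambda> \<tau>))
        \<le> (W (sup \<sigma> \<tau>) * W (inf \<sigma> \<tau>))
          * (f3 (sup (extend_spins \<Lambda> \<sigma>) (extend_spins \<Lambda> \<tau>))
             * f4 (inf (extend_spins \<Lambda> \<sigma>) (extend_spins \<Lambda> \<tau>)))"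
    proof (rule mult_mono)
      show "W \<sigma> * W \<tau> \<le> W (sup \<sigma> \<tau>) * W (inf \<sigma> \<tau>)"
        unfolding W_def by (rule ising_weight_log_supermodular[OF \<open>\<beta> \<ge> 0\<close> \<sigma> \<tau>])
      show "f1 (extend_spins \<Lambda> \<sigma>) * f2 (extend_spins \<Lambda> \<tau>)
          \<le> f3 (sup (extend_spins \<Lambda> \<sigma>) (extend_spins \<Lambda> \<tau>)) * f4 (inf (extend_spins \<Lambda> \<sigma>) (extend_spins \<Lambda> \<tau>))"
        using le extend_spins_in_configs[OF \<sigma>] extend_spins_in_configs[OF \<tau>] by blast
      show "0 \<le> W (sup \<sigma> \<tau>) * W (inf \<sigma> \<tau>)"
        by (intro mult_nonneg_nonneg W)
      show "0 \<le> f1 (extend_spins \<Lambda> \<sigma>) * f2 (extend_spins \<Lambda> \<tau>)"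
        using nonneg extend_spins_in_configs[OF \<sigma>] extend_spins_in_configs[OF \<tau>] by simp
    qed
    then show "g f1 \<sigma> * g f2 \<tau> \<le> g f3 (sup \<sigma> \<tau>) * g f4 (inf \<sigma> \<tau>)"
      by (simp add: g_def extend_spins_sup_inf mult_ac)
  next
    fix \<sigma> assume "\<sigma> \<in> spin_configs \<Lambda>"
    with nonneg W show "0 \<le> g f1 \<sigma> \<and> 0 \<le> g f2 \<sigma> \<and> 0 \<le> g f3 \<sigma> \<and> 0 \<le> g f4 \<sigma>"
      using extend_spins_in_configs unfolding g_def by (blast intro: mult_nonneg_nonneg)
  qed
  then show "(\<integral>\<sigma>. f1 \<sigma> \<partial>ising_finite_ext \<beta> h \<Lambda>) * (\<integral>\<sigma>. f2 \<sigma> \<partial>ising_finite_ext \<beta> h \<Lambda>)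
      \<le> (\<integral>\<sigma>. f3 \<sigma> \<partial>ising_finite_ext \<beta> h \<Lambda>) * (\<integral>\<sigma>. f4 \<sigma> \<partial>ising_finite_ext \<beta> h \<Lambda>)"
    unfolding integral[OF obs(1)] integral[OF obs(2)] integral[OF obs(3)] integral[OF obs(4)]
    by (simp add: divide_right_mono)
qed

lemma tendsto_weak_limit:
  "weak_limit N \<mu> F \<Longrightarrow> observable f \<Longrightarrow> ((\<lambda>a. \<integral>\<sigma>. f \<sigma> \<partial>N a) \<longlongrightarrow> (\<integral>\<sigma>. f \<sigma> \<partial>\<mu>)) F"
  by (simp add: weak_limit_def observable_def)

lemma four_functions_weak_limit:
  fixes \<mu> :: "('s \<Rightarrow> real) measure"
  assumes lim: "weak_limit N \<mu> F" and "F \<noteq> bot"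
    and ev: "\<forall>\<^sub>F a in F. four_functions_measure (N a)"
  shows "four_functions_measure \<mu>"
  unfolding four_functions_measure_def
proof (intro allI impI, elim conjE)
  fix f1 f2 f3 f4 :: "('s \<Rightarrow> real) \<Rightarrow> real"
  assume obs: "observable f1" "observable f2" "observable f3" "observable f4"
    and nonneg: "\<forall>\<sigma>\<in>spin_configs UNIV. 0 \<le> f1 \<sigma> \<and> 0 \<le> f2 \<sigma> \<and> 0 \<le> f3 \<sigma> \<and> 0 \<le> f4 \<sigma>"
    and le: "\<forall>\<sigma>\<in>spin_configs UNIV. \<forall>\<tau>\<in>spin_configs UNIV. f1 \<sigma> * f2 \<tau> \<le> f3 (sup \<sigma> \<tau>) * f4 (inf \<sigma> \<tau>)"
  show "(\<integral>\<sigma>. f1 \<sigma> \<partial>\<mu>) * (\<integral>\<sigma>. f2 \<sigma> \<partial>\<mu>) \<le> (\<integral>\<sigma>. f3 \<sigma> \<partial>\<mu>) * (\<integral>\<sigma>. f4 \<sigma> \<partial>\<mu>)"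
  proof (rule tendsto_le[OF \<open>F \<noteq> bot\<close>])
    show "((\<lambda>a. (\<integral>\<sigma>. f1 \<sigma> \<partial>N a) * (\<integral>\<sigma>. f2 \<sigma> \<partial>N a)) \<longlongrightarrow> (\<integral>\<sigma>. f1 \<sigma> \<partial>\<mu>) * (\<integral>\<sigma>. f2 \<sigma> \<partial>\<mu>)) F"
      and "((\<lambda>a. (\<integral>\<sigma>. f3 \<sigma> \<partial>N a) * (\<integral>\<sigma>. f4 \<sigma> \<partial>N a)) \<longlongrightarrow> (\<integral>\<sigma>. f3 \<sigma> \<partial>\<mu>) * (\<integral>\<sigma>. f4 \<sigma> \<partial>\<mu>)) F"
      by (intro tendsto_mult tendsto_weak_limit[OF lim] obs)+
    show "\<forall>\<^sub>F a in F. (\<integral>\<sigma>. f1 \<sigma> \<partial>N a) * (\<integral>\<sigma>. f2 \<sigma> \<partial>N a) \<le> (\<integral>\<sigma>. f3 \<sigma> \<partial>N a) * (\<integral>\<sigma>. f4 \<sigma> \<partial>N a)"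
      using ev
    proof eventually_elim
      case (elim a)
      show ?case
        by (rule elim[unfolded four_functions_measure_def, rule_format]) (use obs nonneg le in blast)
    qed
  qed
qed

text \<open>
  The states with a field and the limits of vanishing field are treated alike by any property that is
  closed under weak limits.
\<close>

lemma ising_state_induct:
  assumes "ising_state \<beta> \<mu>"
    and field: "\<And>h \<mu>. ising_field_state \<beta> h \<mu> \<Longrightarrow> P \<mu>"
    and limit: "\<And>M \<mu> F. weak_limit M \<mu> F \<Longrightarrow> F \<noteq> bot \<Longrightarrow> \<forall>\<^sub>F h :: real in F. P (M h) \<Longrightarrow> P \<mu>"
  shows "P \<mu>"
  using assms(1) unfolding ising_state_def
proof (elim disjE exE conjE)
  assume "ising_plus_state \<beta> \<mu>"
  then obtain M where M: "\<And>h. h > 0 \<Longrightarrow> ising_field_state \<beta> h (M h)" "weak_limit M \<mu> (at_right 0)"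
    by (auto simp: ising_plus_state_def)
  show "P \<mu>"
    by (rule limit[OF M(2)]) (use M(1) field in \<open>auto simp: eventually_at_filter intro!: always_eventually\<close>)
next
  assume "ising_minus_state \<beta> \<mu>"
  then obtain M where M: "\<And>h. h < 0 \<Longrightarrow> ising_field_state \<beta> h (M h)" "weak_limit M \<mu> (at_left 0)"
    by (auto simp: ising_minus_state_def)
  show "P \<mu>"
    by (rule limit[OF M(2)]) (use M(1) field in \<open>auto simp: eventually_at_filter intro!: always_eventually\<close>)
qed (use field in blast)

theorem four_functions_ising_state:
  assumes "\<beta> \<ge> 0" and "ising_state \<beta> \<mu>"
  shows "four_functions_measure \<mu>"
  using assms(2)
proof (rule ising_state_induct)
  fix h and \<mu>' :: "('a site \<Rightarrow> real) measure"
  assume "ising_field_state \<beta> h \<mu>'"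
  then have "weak_limit (ising_finite_ext \<beta> h) \<mu>' (finite_subsets_at_top UNIV)"
    by (simp add: ising_field_state_def)
  moreover have "\<forall>\<^sub>F \<Lambda> in finite_subsets_at_top UNIV. four_functions_measure (ising_finite_ext \<beta> h \<Lambda> :: ('a site \<Rightarrow> real) measure)"
    by (rule eventually_finite_subsets_at_top_weakI) (rule four_functions_ising_finite[OF assms(1)])
  ultimately show "four_functions_measure \<mu>'"
    using four_functions_weak_limit finite_subsets_at_top_neq_bot by blast
qed (rule four_functions_weak_limit)

section \<open>Translation invariance\<close>

definition translation_invariant :: "('s::plus \<Rightarrow> real) measure \<Rightarrow> bool" where
  "translation_invariant \<mu> \<longleftrightarrow>
     (\<forall>a f. observable f \<longrightarrow> (\<integral>\<sigma>. f (\<lambda>x. \<sigma> (x + a)) \<partial>\<mu>) = (\<integral>\<sigma>. f \<sigma> \<partial>\<mu>))"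

lemma nn_pairs_translate:
  fixes \<Lambda> :: "'d::finite site set"
  shows "nn_pairs ((\<lambda>x. x - a) ` \<Lambda>) = (`) (\<lambda>x. x - a) ` nn_pairs \<Lambda>"
proof (intro equalityI subsetI)
  fix e assume "e \<in> nn_pairs ((\<lambda>x. x - a) ` \<Lambda>)"
  then obtain x y where "e = {x - a, y - a}" "x \<in> \<Lambda>" "y \<in> \<Lambda>" "site_norm ((x - a) - (y - a)) = 1"
    unfolding nn_pairs_def by blast
  then have "e = (\<lambda>x. x - a) ` {x, y}" "x \<in> \<Lambda>" "y \<in> \<Lambda>" "site_norm (x - y) = 1"
    by simp_all
  then show "e \<in> (`) (\<lambda>x. x - a) ` nn_pairs \<Lambda>"
    unfolding nn_pairs_def by blast
next
  fix e assume "e \<in> (`) (\<lambda>x. x - a) ` nn_pairs \<Lambda>"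
  then obtain x y where "e = (\<lambda>x. x - a) ` {x, y}" "x \<in> \<Lambda>" "y \<in> \<Lambda>" "site_norm (x - y) = 1"
    unfolding nn_pairs_def by blast
  then have e: "e = {x - a, y - a}" "x \<in> \<Lambda>" "y \<in> \<Lambda>" "site_norm (x - y) = 1"
    by simp_all
  then have "site_norm ((x - a) - (y - a)) = 1"
    by simp
  with e show "e \<in> nn_pairs ((\<lambda>x. x - a) ` \<Lambda>)"
    unfolding nn_pairs_def by blast
qed

lemma ising_weight_translate:
  fixes \<Lambda> :: "'d::finite site set"
  shows "ising_weight \<beta> h ((\<lambda>x. x - a) ` \<Lambda>) (\<lambda>x. \<sigma> (x + a)) = ising_weight \<beta> h \<Lambda> \<sigma>"
proof -
  let ?g = "\<lambda>x :: 'd site. x - a"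
  have inj: "inj ?g"
    by (simp add: inj_on_def)
  have "(\<Prod>x\<in>?g ` e. \<sigma> (x + a)) = (\<Prod>x\<in>e. \<sigma> x)" for e
    by (subst prod.reindex[OF inj_on_subset[OF inj]]) auto
  moreover have inj_on_image_set: "inj_on ((`) ?g) (nn_pairs \<Lambda>)"
    using inj by (meson inj_onI inj_image_eq_iff)
  ultimately have "(\<Sum>e\<in>nn_pairs (?g ` \<Lambda>). (\<Prod>x\<in>e. \<sigma> (x + a)) - 1) = (\<Sum>e\<in>nn_pairs \<Lambda>. (\<Prod>x\<in>e. \<sigma> x) - 1)"
    unfolding nn_pairs_translate
    by (subst sum.reindex[OF inj_on_image_set]) auto
  moreover have "(\<Sum>x\<in>?g ` \<Lambda>. \<sigma> (x + a)) = (\<Sum>x\<in>\<Lambda>. \<sigma> x)"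
    by (subst sum.reindex[OF inj_on_subset[OF inj]]) auto
  ultimately show ?thesis
    by (simp add: ising_weight_def)
qed

text \<open>
  Both the energy and the extension of configurations by \<open>1\<close> commute with translations, so a
  translation of the observable is a translation of the volume.
\<close>

lemma integral_ising_finite_translate:
  fixes \<Lambda> :: "'d::finite site set"
  assumes "finite \<Lambda>" and "observable f"
  shows "(\<integral>\<sigma>. f (\<lambda>x. \<sigma> (x + a)) \<partial>ising_finite_ext \<beta> h \<Lambda>)
    = (\<integral>\<sigma>. f \<sigma> \<partial>ising_finite_ext \<beta> h ((\<lambda>x. x - a) ` \<Lambda>))"
proof -
  define \<Lambda>' where "\<Lambda>' = (\<lambda>x. x - a) ` \<Lambda>"
  have mem: "x \<in> \<Lambda>' \<longleftrightarrow> x + a \<in> \<Lambda>" for x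
    by (force simp: \<Lambda>'_def)
  have bij: "bij_betw (\<lambda>\<sigma> x. \<sigma> (x + a)) (spin_configs \<Lambda>) (spin_configs \<Lambda>')"
    by (rule bij_betw_byWitness[where f' = "\<lambda>\<sigma> x. \<sigma> (x - a)"])
       (auto simp: spin_configs_def PiE_iff extensional_def mem simp del: split_paired_All)
  have "(\<Sum>\<sigma>\<in>spin_configs \<Lambda>'. ising_weight \<beta> h \<Lambda>' \<sigma> * f (extend_spins \<Lambda>' \<sigma>))
      = (\<Sum>\<sigma>\<in>spin_configs \<Lambda>. ising_weight \<beta> h \<Lambda> \<sigma> * f (\<lambda>x. extend_spins \<Lambda> \<sigma> (x + a)))"
    by (subst sum.reindex_bij_betw[OF bij, symmetric])
       (simp add: \<Lambda>'_def[symmetric] ising_weight_translate[of _ _ a \<Lambda>, unfolded \<Lambda>'_def[symmetric]]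
          extend_spins_def mem)
  moreover have "(\<Sum>\<sigma>\<in>spin_configs \<Lambda>'. ising_weight \<beta> h \<Lambda>' \<sigma>) = (\<Sum>\<sigma>\<in>spin_configs \<Lambda>. ising_weight \<beta> h \<Lambda> \<sigma>)"
    by (subst sum.reindex_bij_betw[OF bij, symmetric])
       (simp add: ising_weight_translate[of _ _ a \<Lambda>, unfolded \<Lambda>'_def[symmetric]])
  moreover have "finite \<Lambda>'"
    using assms(1) by (simp add: \<Lambda>'_def)
  ultimately show ?thesis
    using assms observable_reindex[OF assms(2), of "\<lambda>x. x + a"]
    by (simp add: integral_ising_finite_ext observable_def \<Lambda>'_def[symmetric])
qed

text \<open>
  Translating all volumes maps the filter of growing finite volumes to itself, so the finite volume
  expectations of an observable and of its translate have the same limit.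
\<close>

theorem translation_invariant_ising_state:
  fixes \<mu> :: "('d::finite site \<Rightarrow> real) measure"
  assumes "ising_state \<beta> \<mu>"
  shows "translation_invariant \<mu>"
  using assms
proof (rule ising_state_induct)
  fix h and \<mu>' :: "('d site \<Rightarrow> real) measure"
  assume "ising_field_state \<beta> h \<mu>'"
  then have lim: "weak_limit (ising_finite_ext \<beta> h) \<mu>' (finite_subsets_at_top UNIV)"
    by (simp add: ising_field_state_def)
  show "translation_invariant \<mu>'"
    unfolding translation_invariant_def
  proof (intro allI impI)
    fix a :: "'d site" and f :: "('d site \<Rightarrow> real) \<Rightarrow> real"
    assume f: "observable f"
    let ?g = "\<lambda>x :: 'd site. x - a"
    have "range ?g = UNIV"
      by (rule surjI[of _ "\<lambda>x. x + a"]) simp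
    then have "filterlim ((`) ?g) (finite_subsets_at_top UNIV) (finite_subsets_at_top UNIV)"
      using filtermap_image_finite_subsets_at_top[of ?g UNIV] by (simp add: filterlim_def inj_on_def)
    from filterlim_compose[OF tendsto_weak_limit[OF lim f] this]
    have "((\<lambda>\<Lambda>. \<integral>\<sigma>. f \<sigma> \<partial>ising_finite_ext \<beta> h (?g ` \<Lambda>)) \<longlongrightarrow> (\<integral>\<sigma>. f \<sigma> \<partial>\<mu>')) (finite_subsets_at_top UNIV)" .
    moreover have "((\<lambda>\<Lambda>. \<integral>\<sigma>. f \<sigma> \<partial>ising_finite_ext \<beta> h (?g ` \<Lambda>)) \<longlongrightarrow> (\<integral>\<sigma>. f (\<lambda>x. \<sigma> (x + a)) \<partial>\<mu>'))
        (finite_subsets_at_top UNIV)"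
      by (rule Lim_transform_eventually[OF tendsto_weak_limit[OF lim observable_reindex[OF f]]])
         (auto intro!: eventually_finite_subsets_at_top_weakI integral_ising_finite_translate f)
    ultimately show "(\<integral>\<sigma>. f (\<lambda>x. \<sigma> (x + a)) \<partial>\<mu>') = (\<integral>\<sigma>. f \<sigma> \<partial>\<mu>')"
      by (blast intro: tendsto_unique[OF finite_subsets_at_top_neq_bot])
  qed
next
  fix M :: "real \<Rightarrow> ('d site \<Rightarrow> real) measure" and \<mu>' F
  assume lim: "weak_limit M \<mu>' F" and "F \<noteq> bot" and ev: "\<forall>\<^sub>F h in F. translation_invariant (M h)"
  show "translation_invariant \<mu>'"
    unfolding translation_invariant_def
  proof (intro allI impI)
    fix a :: "'d site" and f :: "('d site \<Rightarrow> real) \<Rightarrow> real"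
    assume f: "observable f"
    have "((\<lambda>h. \<integral>\<sigma>. f \<sigma> \<partial>M h) \<longlongrightarrow> (\<integral>\<sigma>. f (\<lambda>x. \<sigma> (x + a)) \<partial>\<mu>')) F"
      by (rule Lim_transform_eventually[OF tendsto_weak_limit[OF lim observable_reindex[OF f]]])
         (use ev in eventually_elim, use f in \<open>unfold translation_invariant_def, blast\<close>)
    then show "(\<integral>\<sigma>. f (\<lambda>x. \<sigma> (x + a)) \<partial>\<mu>') = (\<integral>\<sigma>. f \<sigma> \<partial>\<mu>')"
      using tendsto_weak_limit[OF lim f] \<open>F \<noteq> bot\<close> by (blast intro: tendsto_unique)
  qed
qed

lemma translation_invariant_cov:
  assumes "translation_invariant \<mu>"
  shows "cov \<mu> (\<lambda>X. X (x + a)) (\<lambda>X. X (y + a)) = cov \<mu> (\<lambda>X. X x) (\<lambda>X. X y)"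
proof -
  have "(\<integral>X. X (x + a) * X (y + a) \<partial>\<mu>) = (\<integral>X. X x * X y \<partial>\<mu>)"
    using assms observable_mult[OF observable_spin observable_spin, of x y]
    unfolding translation_invariant_def by blast
  moreover have "(\<integral>X. X (z + a) \<partial>\<mu>) = (\<integral>X. X z \<partial>\<mu>)" for z
    using assms observable_spin[of z] unfolding translation_invariant_def by blast
  ultimately show ?thesis
    by (simp add: cov_def)
qed

section \<open>Atoms of finitely many spins\<close>

text \<open>
  The indicator function of the event that the configuration agrees with \<open>a\<close> on \<open>T\<close>; for
  \<open>a \<in> spin_configs T\<close> these events are the atoms of the \<open>\<sigma>\<close>-algebra generated by the spins in \<open>T\<close>.
\<close>

definition atom :: "'s set \<Rightarrow> ('s \<Rightarrow> real) \<Rightarrow> ('s \<Rightarrow> real) \<Rightarrow> real" where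
  "atom T a \<xi> = (if \<forall>i\<in>T. \<xi> i = a i then 1 else 0)"

lemma atom_bounds: "0 \<le> atom T a \<xi>" "atom T a \<xi> \<le> 1"
  by (auto simp: atom_def)

lemma observable_cong:
  assumes "\<And>\<sigma>. \<sigma> \<in> spin_configs UNIV \<Longrightarrow> f \<sigma> = g \<sigma>" and "observable g"
  shows "observable f"
proof -
  have "f \<in> borel_measurable spin_space \<longleftrightarrow> g \<in> borel_measurable spin_space"
    by (rule measurable_cong) (simp add: space_spin_space assms(1))
  moreover have "continuous_on (spin_configs UNIV) f \<longleftrightarrow> continuous_on (spin_configs UNIV) g"
    by (rule continuous_on_cong) (simp_all add: assms(1))
  ultimately show ?thesis
    using assms(2) by (simp add: observable_def)
qed

text \<open>
  On spin configurations the indicator coincides with a polynomial in the spins, hence is continuous.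
\<close>

lemma observable_atom:
  assumes "finite T" and a: "a \<in> spin_configs T"
  shows "observable (atom T a)"
proof (rule observable_cong)
  show "observable (\<lambda>\<xi>. \<Prod>i\<in>T. (1 + a i * \<xi> i) / 2)"
    by (auto simp: observable_def intro!: continuous_intros continuous_on_subset[OF continuous_on_product_coordinates])
  show "atom T a \<xi> = (\<Prod>i\<in>T. (1 + a i * \<xi> i) / 2)" if "\<xi> \<in> spin_configs UNIV" for \<xi>
  proof -
    have "(1 + a i * \<xi> i) / 2 = (if \<xi> i = a i then 1 else 0)" if "i \<in> T" for i
      using a \<open>i \<in> T\<close> spin_configs_UNIV_cases[OF \<open>\<xi> \<in> _\<close>, of i] by (auto simp: spin_configs_def PiE_iff)
    then have "(\<Prod>i\<in>T. (1 + a i * \<xi> i) / 2) = (\<Prod>i\<in>T. if \<xi> i = a i then 1 else 0)"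
      by (rule prod.cong[OF refl])
    also have "\<dots> = atom T a \<xi>"
      using assms(1) by (auto simp: atom_def intro!: prod.neutral)
    finally show ?thesis by simp
  qed
qed

lemma atom_sup_inf:
  "atom T a \<sigma> * atom T b \<tau> \<le> atom T (sup a b) (sup \<sigma> \<tau>) * atom T (inf a b) (inf \<sigma> \<tau>)"
  by (auto simp: atom_def)

lemma restrict_in_spin_configs: "\<xi> \<in> spin_configs UNIV \<Longrightarrow> restrict \<xi> T \<in> spin_configs T"
  by (auto simp: spin_configs_def PiE_iff)

lemma sum_atoms:
  assumes "finite T" and "\<xi> \<in> spin_configs UNIV"
  shows "(\<Sum>a\<in>spin_configs T. atom T a \<xi> * G a) = G (restrict \<xi> T)"
proof -
  have "(\<Sum>a\<in>spin_configs T. atom T a \<xi> * G a) = (\<Sum>a\<in>spin_configs T. if a = restrict \<xi> T then G a else 0)"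
  proof (rule sum.cong[OF refl])
    fix a assume "a \<in> spin_configs T"
    then have "(\<forall>i\<in>T. \<xi> i = a i) \<longleftrightarrow> a = restrict \<xi> T"
      by (auto simp: spin_configs_def PiE_iff extensional_def fun_eq_iff)
    then show "atom T a \<xi> * G a = (if a = restrict \<xi> T then G a else 0)"
      by (simp add: atom_def)
  qed
  then show ?thesis
    using finite_spin_configs[OF assms(1)] restrict_in_spin_configs[OF assms(2)] by (simp add: sum.delta')
qed

lemma sum_atoms_eq_1:
  "finite T \<Longrightarrow> \<xi> \<in> spin_configs UNIV \<Longrightarrow> (\<Sum>a\<in>spin_configs T. atom T a \<xi>) = 1"
  using sum_atoms[of T \<xi> "\<lambda>_. 1"] by simp

section \<open>Approximation by cylinder functions\<close>

locale spin_field = prob_space \<nu> for \<nu> :: "('s \<Rightarrow> real) measure" +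
  assumes sets_eq [measurable_cong]: "sets \<nu> = sets spin_space"
begin

lemma space_eq: "space \<nu> = spin_configs UNIV"
  using sets_eq_imp_space_eq[OF sets_eq] by (simp add: space_spin_space)

lemma atom_measurable [measurable]:
  "finite T \<Longrightarrow> a \<in> spin_configs T \<Longrightarrow> atom T a \<in> borel_measurable \<nu>"
  using observable_atom measurable_cong_sets[OF sets_eq refl] by (auto simp: observable_def)

lemma integrable_bounded:
  fixes f :: "('s \<Rightarrow> real) \<Rightarrow> real"
  assumes "f \<in> borel_measurable \<nu>" and "\<And>\<xi>. \<xi> \<in> spin_configs UNIV \<Longrightarrow> \<bar>f \<xi>\<bar> \<le> B"
  shows "integrable \<nu> f"
  using assms by (intro integrable_const_bound[of _ B] AE_I2) (auto simp: space_eq)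

lemma integrable_times_bounded:
  fixes f g :: "('s \<Rightarrow> real) \<Rightarrow> real"
  assumes f: "integrable \<nu> f" and g [measurable]: "g \<in> borel_measurable \<nu>"
    and bound: "\<And>\<xi>. \<xi> \<in> spin_configs UNIV \<Longrightarrow> \<bar>g \<xi>\<bar> \<le> 1"
  shows "integrable \<nu> (\<lambda>\<xi>. f \<xi> * g \<xi>)"
proof (rule Bochner_Integration.integrable_bound[OF f])
  show "(\<lambda>\<xi>. f \<xi> * g \<xi>) \<in> borel_measurable \<nu>"
    using f by measurable
  show "AE \<xi> in \<nu>. norm (f \<xi> * g \<xi>) \<le> norm (f \<xi>)"
    using bound by (intro AE_I2) (auto simp: abs_mult space_eq intro!: mult_left_le)
qed

lemma integrable_times_atom:
  "integrable \<nu> f \<Longrightarrow> finite T \<Longrightarrow> a \<in> spin_configs T \<Longrightarrow> integrable \<nu> (\<lambda>\<xi>. f \<xi> * atom T a \<xi>)"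
  by (rule integrable_times_bounded) (auto simp: atom_def)

lemma sum_integral_atoms:
  assumes "integrable \<nu> f" and "finite T"
  shows "(\<Sum>a\<in>spin_configs T. \<integral>\<xi>. f \<xi> * atom T a \<xi> \<partial>\<nu>) = (\<integral>\<xi>. f \<xi> \<partial>\<nu>)"
proof -
  have "(\<Sum>a\<in>spin_configs T. \<integral>\<xi>. f \<xi> * atom T a \<xi> \<partial>\<nu>)
      = (\<integral>\<xi>. (\<Sum>a\<in>spin_configs T. f \<xi> * atom T a \<xi>) \<partial>\<nu>)"
    by (rule Bochner_Integration.integral_sum[symmetric]) (rule integrable_times_atom[OF assms])
  also have "\<dots> = (\<integral>\<xi>. f \<xi> \<partial>\<nu>)"
    by (rule Bochner_Integration.integral_cong)
       (auto simp: space_eq sum_distrib_left[symmetric] sum_atoms_eq_1[OF assms(2)])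
  finally show ?thesis .
qed

lemma integrable_cylinder:
  assumes "finite T"
  shows "integrable \<nu> (\<lambda>\<xi>. G (restrict \<xi> T) :: real)"
proof -
  have "integrable \<nu> (\<lambda>\<xi>. \<Sum>a\<in>spin_configs T. G a * atom T a \<xi>)"
    by (intro Bochner_Integration.integrable_sum integrable_times_atom assms) auto
  then show ?thesis
    by (rule Bochner_Integration.integrable_cong[THEN iffD1, rotated -1])
       (auto simp: space_eq sum_atoms[OF assms, symmetric] mult.commute)
qed

definition cylinder_approximable :: "(('s \<Rightarrow> real) \<Rightarrow> real) \<Rightarrow> bool" where
  "cylinder_approximable f \<longleftrightarrow>
     (\<forall>\<epsilon>>0. \<exists>T G. finite T \<and> (\<integral>\<xi>. \<bar>f \<xi> - G (restrict \<xi> T)\<bar> \<partial>\<nu>) < \<epsilon>)"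

lemma cylinder_approximable_close:
  assumes f: "integrable \<nu> f"
    and close: "\<And>\<epsilon>. \<epsilon> > 0 \<Longrightarrow>
      \<exists>g. integrable \<nu> g \<and> cylinder_approximable g \<and> (\<integral>\<xi>. \<bar>f \<xi> - g \<xi>\<bar> \<partial>\<nu>) < \<epsilon>"
  shows "cylinder_approximable f"
  unfolding cylinder_approximable_def
proof (intro allI impI)
  fix \<epsilon> :: real assume "\<epsilon> > 0"
  then obtain g where g: "integrable \<nu> g" "cylinder_approximable g" "(\<integral>\<xi>. \<bar>f \<xi> - g \<xi>\<bar> \<partial>\<nu>) < \<epsilon> / 2"
    using close[of "\<epsilon> / 2"] by auto
  then obtain T G where T: "finite T" "(\<integral>\<xi>. \<bar>g \<xi> - G (restrict \<xi> T)\<bar> \<partial>\<nu>) < \<epsilon> / 2"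
    using \<open>\<epsilon> > 0\<close> unfolding cylinder_approximable_def by (meson half_gt_zero)
  note G = integrable_cylinder[OF T(1), of G]
  have "(\<integral>\<xi>. \<bar>f \<xi> - G (restrict \<xi> T)\<bar> \<partial>\<nu>)
      \<le> (\<integral>\<xi>. \<bar>f \<xi> - g \<xi>\<bar> + \<bar>g \<xi> - G (restrict \<xi> T)\<bar> \<partial>\<nu>)"
    using f g(1) G by (intro integral_mono) auto
  also have "\<dots> = (\<integral>\<xi>. \<bar>f \<xi> - g \<xi>\<bar> \<partial>\<nu>) + (\<integral>\<xi>. \<bar>g \<xi> - G (restrict \<xi> T)\<bar> \<partial>\<nu>)"
    using f g(1) G by (intro Bochner_Integration.integral_add) auto
  also have "\<dots> < \<epsilon>"
    using g(3) T(2) by linarith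
  finally show "\<exists>T G. finite T \<and> (\<integral>\<xi>. \<bar>f \<xi> - G (restrict \<xi> T)\<bar> \<partial>\<nu>) < \<epsilon>"
    using T(1) by blast
qed

text \<open>
  Approximations of \<open>f\<close> and \<open>g\<close> combine to one of \<open>\<phi> f g\<close> over the union of the two finite sets;
  used for sums, differences and maxima.
\<close>

lemma cylinder_approximable_combine:
  assumes f: "integrable \<nu> f" "cylinder_approximable f" and g: "integrable \<nu> g" "cylinder_approximable g"
    and \<phi>: "\<And>x y x' y' :: real. \<bar>\<phi> x y - \<phi> x' y'\<bar> \<le> \<bar>x - x'\<bar> + \<bar>y - y'\<bar>"
    and int: "integrable \<nu> (\<lambda>\<xi>. \<phi> (f \<xi>) (g \<xi>))"
  shows "cylinder_approximable (\<lambda>\<xi>. \<phi> (f \<xi>) (g \<xi>))"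
  unfolding cylinder_approximable_def
proof (intro allI impI)
  fix \<epsilon> :: real assume "\<epsilon> > 0"
  then obtain T G where T: "finite T" "(\<integral>\<xi>. \<bar>f \<xi> - G (restrict \<xi> T)\<bar> \<partial>\<nu>) < \<epsilon> / 2"
    using f(2) unfolding cylinder_approximable_def by (meson half_gt_zero)
  obtain S H where S: "finite S" "(\<integral>\<xi>. \<bar>g \<xi> - H (restrict \<xi> S)\<bar> \<partial>\<nu>) < \<epsilon> / 2"
    using g(2) \<open>\<epsilon> > 0\<close> unfolding cylinder_approximable_def by (meson half_gt_zero)
  define K where "K = (\<lambda>\<xi>. \<phi> (G (restrict \<xi> T)) (H (restrict \<xi> S)))"
  have K: "K (restrict \<xi> (T \<union> S)) = \<phi> (G (restrict \<xi> T)) (H (restrict \<xi> S))" for \<xi>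
    by (simp add: K_def Int_absorb1 Int_absorb2 inf_commute)
  note G = integrable_cylinder[OF T(1), of G] and H = integrable_cylinder[OF S(1), of H]
    and int' = integrable_cylinder[of "T \<union> S" K, unfolded K]
  have "(\<integral>\<xi>. \<bar>\<phi> (f \<xi>) (g \<xi>) - K (restrict \<xi> (T \<union> S))\<bar> \<partial>\<nu>)
      \<le> (\<integral>\<xi>. \<bar>f \<xi> - G (restrict \<xi> T)\<bar> + \<bar>g \<xi> - H (restrict \<xi> S)\<bar> \<partial>\<nu>)"
    unfolding K using f(1) g(1) G H int int' T(1) S(1) by (intro integral_mono \<phi>) auto
  also have "\<dots> = (\<integral>\<xi>. \<bar>f \<xi> - G (restrict \<xi> T)\<bar> \<partial>\<nu>) + (\<integral>\<xi>. \<bar>g \<xi> - H (restrict \<xi> S)\<bar> \<partial>\<nu>)"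
    using f(1) g(1) G H by (intro Bochner_Integration.integral_add) auto
  also have "\<dots> < \<epsilon>"
    using T(2) S(2) by linarith
  finally show "\<exists>T G. finite T \<and> (\<integral>\<xi>. \<bar>\<phi> (f \<xi>) (g \<xi>) - G (restrict \<xi> T)\<bar> \<partial>\<nu>) < \<epsilon>"
    using T(1) S(1) by blast
qed

lemma cylinder_approximable_cylinder:
  assumes "finite T" and "\<And>\<xi>. \<xi> \<in> spin_configs UNIV \<Longrightarrow> f \<xi> = G (restrict \<xi> T)"
  shows "cylinder_approximable f"
  unfolding cylinder_approximable_def
proof (intro allI impI)
  fix \<epsilon> :: real assume "\<epsilon> > 0"
  have "(\<integral>\<xi>. \<bar>f \<xi> - G (restrict \<xi> T)\<bar> \<partial>\<nu>) = (\<integral>\<xi>. 0 \<partial>\<nu>)"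
    by (rule Bochner_Integration.integral_cong) (auto simp: space_eq assms(2))
  then show "\<exists>T G. finite T \<and> (\<integral>\<xi>. \<bar>f \<xi> - G (restrict \<xi> T)\<bar> \<partial>\<nu>) < \<epsilon>"
    using assms(1) \<open>\<epsilon> > 0\<close> by (intro exI[of _ T] exI[of _ G]) simp
qed

lemma cylinder_approximable_cong:
  assumes "\<And>\<xi>. \<xi> \<in> spin_configs UNIV \<Longrightarrow> f \<xi> = g \<xi>" and "cylinder_approximable g"
  shows "cylinder_approximable f"
proof -
  have "(\<integral>\<xi>. \<bar>f \<xi> - G (restrict \<xi> T)\<bar> \<partial>\<nu>) = (\<integral>\<xi>. \<bar>g \<xi> - G (restrict \<xi> T)\<bar> \<partial>\<nu>)" for G T
    by (rule Bochner_Integration.integral_cong) (auto simp: space_eq assms(1))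
  with assms(2) show ?thesis
    by (simp add: cylinder_approximable_def)
qed

text \<open>
  The approximable events contain the events depending on one spin and are closed under complements
  and finite unions, the latter because the indicator of a union is a maximum. Continuity of \<open>\<nu>\<close> from
  below adds countable unions.
\<close>

lemma cylinder_approximable_indicator:
  assumes "A \<in> sets \<nu>"
  shows "cylinder_approximable (indicator A)"
proof -
  let ?E = "{{\<xi> \<in> (\<Pi>\<^sub>E i\<in>UNIV. {-1, 1}). \<xi> i \<in> B} | i B. i \<in> UNIV \<and> B \<in> sets (count_space {-1, 1::real})}"
  have sets: "sets \<nu> = sigma_sets (\<Pi>\<^sub>E i\<in>UNIV. {-1, 1}) ?E"
    unfolding sets_eq spin_space_def sets_PiM_single by simp
  have int: "integrable \<nu> (indicator A :: _ \<Rightarrow> real)" if "A \<in> sets \<nu>" for A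
    using that by (intro integrable_bounded[of _ 1]) auto
  have const: "cylinder_approximable (\<lambda>_. c)" for c
    by (rule cylinder_approximable_cylinder[of "{}" _ "\<lambda>_. c"]) auto
  from assms have "A \<in> sigma_sets (\<Pi>\<^sub>E i\<in>UNIV. {-1, 1}) ?E"
    by (simp add: sets)
  then show ?thesis
  proof (induction rule: sigma_sets.induct)
    case (Basic A)
    then obtain i B where A: "A = {\<xi> \<in> (\<Pi>\<^sub>E i\<in>UNIV. {-1, 1}). \<xi> i \<in> B}"
      by blast
    show ?case
      by (rule cylinder_approximable_cylinder[of "{i}" _ "\<lambda>\<xi>. indicator B (\<xi> i)"])
         (auto simp: A spin_configs_def split: split_indicator)
  next
    case Empty
    then show ?case
      using const[of 0] by (rule cylinder_approximable_cong[rotated]) simp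
  next
    case (Compl A)
    have "cylinder_approximable (\<lambda>\<xi>. 1 - indicator A \<xi>)"
      using Compl by (intro cylinder_approximable_combine[where \<phi> = "\<lambda>x y. x - y"] const) (auto intro!: int simp: sets)
    then show ?case
      by (rule cylinder_approximable_cong[rotated]) (auto simp: spin_configs_def split: split_indicator)
  next
    case (Union A)
    then have meas: "A n \<in> sets \<nu>" for n
      by (simp add: sets)
    have finite_union: "cylinder_approximable (indicator (\<Union>n<N. A n))" for N
    proof (induction N)
      case 0
      then show ?case
        using const[of 0] by (rule cylinder_approximable_cong[rotated]) simp
    next
      case (Suc N)
      have "cylinder_approximable (\<lambda>\<xi>. max (indicator (\<Union>n<N. A n) \<xi>) (indicator (A N) \<xi>))"
        by (intro cylinder_approximable_combine[where \<phi> = max] Suc Union int meas integrable_max sets.finite_UN)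
           (auto simp: max_def meas)
      then show ?case
        by (rule cylinder_approximable_cong[rotated]) (auto simp: lessThan_Suc split: split_indicator)
    qed
    show ?case
    proof (rule cylinder_approximable_close)
      fix \<epsilon> :: real assume "\<epsilon> > 0"
      have "(\<lambda>N. prob (\<Union>n<N. A n)) \<longlonglongrightarrow> prob (\<Union>N. \<Union>n<N. A n)"
        using meas by (intro finite_Lim_measure_incseq) (auto simp: incseq_def intro: less_le_trans)
      also have "(\<Union>N. \<Union>n<N. A n) = (\<Union>n. A n)"
        by auto
      finally have "\<forall>\<^sub>F N in sequentially. prob (\<Union>n<N. A n) > prob (\<Union>n. A n) - \<epsilon>"
        by (rule order_tendstoD) (use \<open>\<epsilon> > 0\<close> in simp)
      then obtain N where N: "prob (\<Union>n<N. A n) > prob (\<Union>n. A n) - \<epsilon>"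
        by (auto simp: eventually_sequentially)
      have [measurable]: "(\<Union>n. A n) \<in> sets \<nu>" "(\<Union>n<N. A n) \<in> sets \<nu>"
        using meas by auto
      have "(\<integral>\<xi>. \<bar>indicator (\<Union>n. A n) \<xi> - indicator (\<Union>n<N. A n) \<xi>\<bar> \<partial>\<nu>)
          = (\<integral>\<xi>. indicator (\<Union>n. A n) \<xi> - indicator (\<Union>n<N. A n) \<xi> \<partial>\<nu> :: real)"
        by (rule Bochner_Integration.integral_cong) (auto split: split_indicator)
      also have "\<dots> = prob (\<Union>n. A n) - prob (\<Union>n<N. A n)"
        by (subst Bochner_Integration.integral_diff) (auto intro!: int)
      also have "\<dots> < \<epsilon>"
        using N by simp
      finally show "\<exists>g. integrable \<nu> g \<and> cylinder_approximable g
          \<and> (\<integral>\<xi>. \<bar>indicator (\<Union>n. A n) \<xi> - g \<xi>\<bar> \<partial>\<nu>) < \<epsilon>"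
        using finite_union[of N] int by (intro exI[of _ "indicator (\<Union>n<N. A n)"]) auto
    qed (use meas in \<open>auto intro!: int\<close>)
  qed
qed

text \<open>
  From indicators to integrable functions by linearity and dominated convergence.
\<close>

theorem cylinder_approximable_integrable:
  assumes "integrable \<nu> f"
  shows "cylinder_approximable f"
  using assms
proof (induction rule: integrable_induct)
  case (base A c)
  show ?case
    unfolding cylinder_approximable_def
  proof (intro allI impI)
    fix \<epsilon> :: real assume "\<epsilon> > 0"
    then have "\<epsilon> / (\<bar>c\<bar> + 1) > 0"
      by simp
    then obtain T G where T: "finite T" "(\<integral>\<xi>. \<bar>indicator A \<xi> - G (restrict \<xi> T)\<bar> \<partial>\<nu>) < \<epsilon> / (\<bar>c\<bar> + 1)"
      using cylinder_approximable_indicator[OF base(1)] unfolding cylinder_approximable_def by meson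
    have "(\<integral>\<xi>. \<bar>indicator A \<xi> *\<^sub>R c - G (restrict \<xi> T) * c\<bar> \<partial>\<nu>)
        = (\<integral>\<xi>. \<bar>indicator A \<xi> - G (restrict \<xi> T)\<bar> * \<bar>c\<bar> \<partial>\<nu>)"
      by (simp add: abs_mult[symmetric] left_diff_distrib)
    also have "\<dots> = (\<integral>\<xi>. \<bar>indicator A \<xi> - G (restrict \<xi> T)\<bar> \<partial>\<nu>) * \<bar>c\<bar>"
      by simp
    also have "\<dots> \<le> (\<integral>\<xi>. \<bar>indicator A \<xi> - G (restrict \<xi> T)\<bar> \<partial>\<nu>) * (\<bar>c\<bar> + 1)"
      by (intro mult_left_mono Bochner_Integration.integral_nonneg) auto
    also have "\<dots> < \<epsilon>"
      using T(2) by (simp add: pos_less_divide_eq add_nonneg_pos)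
    finally show "\<exists>T G. finite T \<and> (\<integral>\<xi>. \<bar>indicator A \<xi> *\<^sub>R c - G (restrict \<xi> T)\<bar> \<partial>\<nu>) < \<epsilon>"
      using T(1) by (intro exI[of _ T] exI[of _ "\<lambda>\<xi>. G \<xi> * c"]) auto
  qed
next
  case (add f g)
  then show ?case
    by (intro cylinder_approximable_combine[where \<phi> = "(+)"]) auto
next
  case (lim f s)
  have s: "integrable \<nu> (s i)" "cylinder_approximable (s i)" for i
    by (rule lim)+
  have f: "integrable \<nu> f"
    by (rule lim)
  have bound: "\<bar>s i \<xi>\<bar> \<le> 2 * \<bar>f \<xi>\<bar>" if "\<xi> \<in> space \<nu>" for i \<xi>
  proof -
    from that have "norm (s i \<xi>) \<le> 2 * norm (f \<xi>)"
      by (rule lim)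
    then show ?thesis
      by simp
  qed
  show ?case
  proof (rule cylinder_approximable_close[OF f])
    fix \<epsilon> :: real assume "\<epsilon> > 0"
    have "(\<lambda>i. \<integral>\<xi>. \<bar>f \<xi> - s i \<xi>\<bar> \<partial>\<nu>) \<longlonglongrightarrow> (\<integral>\<xi>. 0 \<partial>\<nu>)"
    proof (rule integral_dominated_convergence[where w = "\<lambda>\<xi>. 3 * \<bar>f \<xi>\<bar>"])
      show "AE \<xi> in \<nu>. (\<lambda>i. \<bar>f \<xi> - s i \<xi>\<bar>) \<longlonglongrightarrow> 0"
      proof (rule AE_I2)
        fix \<xi> assume "\<xi> \<in> space \<nu>"
        then have "(\<lambda>i. s i \<xi>) \<longlonglongrightarrow> f \<xi>"
          by (rule lim)
        from tendsto_rabs[OF tendsto_diff[OF tendsto_const this, of "f \<xi>"]]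
        show "(\<lambda>i. \<bar>f \<xi> - s i \<xi>\<bar>) \<longlonglongrightarrow> 0"
          by simp
      qed
      show "AE \<xi> in \<nu>. norm \<bar>f \<xi> - s i \<xi>\<bar> \<le> 3 * \<bar>f \<xi>\<bar>" for i
        using bound[of _ i] by (intro AE_I2) fastforce
    qed (use s f in auto)
    then have "\<forall>\<^sub>F i in sequentially. (\<integral>\<xi>. \<bar>f \<xi> - s i \<xi>\<bar> \<partial>\<nu>) < \<epsilon>"
      by (rule order_tendstoD) (use \<open>\<epsilon> > 0\<close> in simp)
    then show "\<exists>g. integrable \<nu> g \<and> cylinder_approximable g \<and> (\<integral>\<xi>. \<bar>f \<xi> - g \<xi>\<bar> \<partial>\<nu>) < \<epsilon>"
      using s by (auto simp: eventually_sequentially)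
  qed
qed

section \<open>Products of conditional expectations\<close>

text \<open>
  On an atom of \<open>T\<close> a function of the spins in \<open>S \<subseteq> T\<close> is constant, so it can be taken out of the
  integral; the price of replacing \<open>u\<close> by it is the contribution of the atom to the \<open>L\<^sup>1\<close> distance.
\<close>

lemma integral_atom_cylinder_error:
  fixes u k :: "('s \<Rightarrow> real) \<Rightarrow> real"
  assumes u: "integrable \<nu> u" and k [measurable]: "k \<in> borel_measurable \<nu>"
    and bound: "\<And>\<xi>. \<xi> \<in> spin_configs UNIV \<Longrightarrow> \<bar>k \<xi>\<bar> \<le> 1"
    and T: "finite T" "S \<subseteq> T" and a: "a \<in> spin_configs T"
  shows "\<bar>(\<integral>\<xi>. u \<xi> * k \<xi> * atom T a \<xi> \<partial>\<nu>) - G (restrict a S) * (\<integral>\<xi>. k \<xi> * atom T a \<xi> \<partial>\<nu>)\<bar>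
    \<le> (\<integral>\<xi>. \<bar>u \<xi> - G (restrict \<xi> S)\<bar> * atom T a \<xi> \<partial>\<nu>)"
proof -
  have "finite S"
    using T finite_subset by blast
  note g = integrable_cylinder[OF this, of G]
  have intk: "integrable \<nu> k"
    by (rule integrable_bounded[of _ 1]) (use bound in auto)
  note int = integrable_times_atom[OF _ T(1) a]
  have restrict: "G (restrict a S) * atom T a \<xi> = G (restrict \<xi> S) * atom T a \<xi>" for \<xi>
  proof (cases "\<forall>i\<in>T. \<xi> i = a i")
    case True
    then have "restrict a S = restrict \<xi> S"
      using T(2) by (intro restrict_ext) auto
    then show ?thesis by simp
  qed (auto simp: atom_def)
  have "(\<integral>\<xi>. u \<xi> * k \<xi> * atom T a \<xi> \<partial>\<nu>) - G (restrict a S) * (\<integral>\<xi>. k \<xi> * atom T a \<xi> \<partial>\<nu>)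
      = (\<integral>\<xi>. u \<xi> * k \<xi> * atom T a \<xi> - G (restrict a S) * (k \<xi> * atom T a \<xi>) \<partial>\<nu>)"
    using int[OF integrable_times_bounded[OF u k bound]] int[OF intk]
    by (subst Bochner_Integration.integral_diff) auto
  also have "\<dots> = (\<integral>\<xi>. (u \<xi> - G (restrict \<xi> S)) * k \<xi> * atom T a \<xi> \<partial>\<nu>)"
  proof (rule Bochner_Integration.integral_cong[OF refl])
    show "u \<xi> * k \<xi> * atom T a \<xi> - G (restrict a S) * (k \<xi> * atom T a \<xi>)
        = (u \<xi> - G (restrict \<xi> S)) * k \<xi> * atom T a \<xi>" for \<xi>
      using restrict[of \<xi>] by (cases "atom T a \<xi> = 0") (auto simp: algebra_simps)
  qed
  also have "\<bar>\<dots>\<bar> \<le> (\<integral>\<xi>. \<bar>u \<xi> - G (restrict \<xi> S)\<bar> * atom T a \<xi> \<partial>\<nu>)"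
  proof (rule order_trans[OF integral_abs_bound integral_mono])
    show "integrable \<nu> (\<lambda>\<xi>. \<bar>(u \<xi> - G (restrict \<xi> S)) * k \<xi> * atom T a \<xi>\<bar>)"
      using u g by (intro integrable_abs int integrable_times_bounded bound) auto
    show "integrable \<nu> (\<lambda>\<xi>. \<bar>u \<xi> - G (restrict \<xi> S)\<bar> * atom T a \<xi>)"
      using u g by (intro int) auto
    show "\<bar>(u \<xi> - G (restrict \<xi> S)) * k \<xi> * atom T a \<xi>\<bar> \<le> \<bar>u \<xi> - G (restrict \<xi> S)\<bar> * atom T a \<xi>"
      if "\<xi> \<in> space \<nu>" for \<xi>
      using bound[of \<xi>] that atom_bounds[of T a \<xi>]
      by (auto simp: abs_mult space_eq intro!: mult_right_mono mult_left_le)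
  qed
  finally show ?thesis .
qed

text \<open>
  On an atom \<open>a\<close>, the quotient of the integral of \<open>u\<close> by the probability of \<open>a\<close> is the conditional
  expectation of \<open>u\<close> given the spins in \<open>T\<close>. The lemma says that replacing \<open>u\<close> by this conditional
  expectation costs little in the integral of \<open>u * v\<close> once \<open>T\<close> is large. It suffices to approximate \<open>u\<close>
  by a cylinder function, as \<open>v\<close> is bounded. On atoms of probability \<open>0\<close> the quotient is \<open>0\<close> by
  convention, which agrees with the vanishing integrals.
\<close>

lemma sum_integral_atom_product_error:
  fixes u v :: "('s \<Rightarrow> real) \<Rightarrow> real"
  assumes u: "integrable \<nu> u" and v [measurable]: "v \<in> borel_measurable \<nu>"
    and bound: "\<And>\<xi>. \<xi> \<in> spin_configs UNIV \<Longrightarrow> \<bar>v \<xi>\<bar> \<le> 1" and "\<epsilon> > 0"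
  shows "\<exists>T0. finite T0 \<and> (\<forall>T. finite T \<longrightarrow> T0 \<subseteq> T \<longrightarrow>
    (\<Sum>a\<in>spin_configs T. \<bar>(\<integral>\<xi>. u \<xi> * v \<xi> * atom T a \<xi> \<partial>\<nu>)
       - (\<integral>\<xi>. u \<xi> * atom T a \<xi> \<partial>\<nu>) * (\<integral>\<xi>. v \<xi> * atom T a \<xi> \<partial>\<nu>) / (\<integral>\<xi>. atom T a \<xi> \<partial>\<nu>)\<bar>) \<le> \<epsilon>)"
proof -
  obtain S G where S: "finite S" "(\<integral>\<xi>. \<bar>u \<xi> - G (restrict \<xi> S)\<bar> \<partial>\<nu>) < \<epsilon> / 2"
    using cylinder_approximable_integrable[OF u] \<open>\<epsilon> > 0\<close>
    unfolding cylinder_approximable_def by (meson half_gt_zero)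
  show ?thesis
  proof (intro exI[of _ S] conjI S(1) allI impI)
    fix T assume T: "finite T" "S \<subseteq> T"
    define e where "e = (\<lambda>a. \<integral>\<xi>. \<bar>u \<xi> - G (restrict \<xi> S)\<bar> * atom T a \<xi> \<partial>\<nu>)"
    define \<alpha> \<beta> n where "\<alpha> = (\<lambda>a. \<integral>\<xi>. u \<xi> * atom T a \<xi> \<partial>\<nu>)" and "\<beta> = (\<lambda>a. \<integral>\<xi>. v \<xi> * atom T a \<xi> \<partial>\<nu>)"
      and "n = (\<lambda>a. \<integral>\<xi>. atom T a \<xi> \<partial>\<nu>)"
    have "\<bar>(\<integral>\<xi>. u \<xi> * v \<xi> * atom T a \<xi> \<partial>\<nu>) - \<alpha> a * \<beta> a / n a\<bar> \<le> 2 * e a" if a: "a \<in> spin_configs T" for a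
    proof -
      have 1: "\<bar>(\<integral>\<xi>. u \<xi> * v \<xi> * atom T a \<xi> \<partial>\<nu>) - G (restrict a S) * \<beta> a\<bar> \<le> e a"
        unfolding \<beta>_def e_def by (rule integral_atom_cylinder_error[OF u v bound T a])
      have 2: "\<bar>\<alpha> a - G (restrict a S) * n a\<bar> \<le> e a"
        using integral_atom_cylinder_error[OF u _ _ T a, of "\<lambda>_. 1" G] by (simp add: \<alpha>_def n_def e_def)
      have int: "integrable \<nu> (atom T a)"
        using integrable_bounded[OF atom_measurable[OF T(1) a], of 1] by (auto simp: atom_def)
      have intv: "integrable \<nu> (\<lambda>\<xi>. v \<xi> * atom T a \<xi>)"
        using integrable_bounded[OF v bound] by (intro integrable_times_atom T(1) a)
      have "\<bar>\<beta> a\<bar> \<le> (\<integral>\<xi>. \<bar>v \<xi> * atom T a \<xi>\<bar> \<partial>\<nu>)"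
        unfolding \<beta>_def by (rule integral_abs_bound)
      also have "\<dots> \<le> n a"
        unfolding n_def using bound atom_bounds[of T a] int intv
        by (intro integral_mono integrable_abs) (auto simp: abs_mult space_eq intro!: mult_left_le_one_le)
      finally have \<beta>: "\<bar>\<beta> a\<bar> \<le> n a" .
      have "\<bar>G (restrict a S) * \<beta> a - \<alpha> a * \<beta> a / n a\<bar> \<le> e a"
      proof (cases "n a = 0")
        case True
        then show ?thesis
          using \<beta> 2 by auto
      next
        case False
        then have "G (restrict a S) * \<beta> a - \<alpha> a * \<beta> a / n a = (\<beta> a / n a) * (G (restrict a S) * n a - \<alpha> a)"
          by (simp add: field_simps)
        also have "\<bar>\<dots>\<bar> = \<bar>\<beta> a\<bar> / \<bar>n a\<bar> * \<bar>\<alpha> a - G (restrict a S) * n a\<bar>"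
          by (simp add: abs_mult abs_divide abs_minus_commute)
        also have "\<dots> \<le> 1 * e a"
          using \<beta> 2 False by (intro mult_mono) (auto simp: divide_le_eq_1)
        finally show ?thesis by simp
      qed
      from order_trans[OF dist_triangle add_mono[OF 1[folded dist_real_def] this[folded dist_real_def]]]
      show ?thesis
        by (simp add: dist_real_def)
    qed
    then have "(\<Sum>a\<in>spin_configs T. \<bar>(\<integral>\<xi>. u \<xi> * v \<xi> * atom T a \<xi> \<partial>\<nu>) - \<alpha> a * \<beta> a / n a\<bar>)
        \<le> (\<Sum>a\<in>spin_configs T. 2 * e a)"
      by (rule sum_mono)
    also have "\<dots> = 2 * (\<integral>\<xi>. \<bar>u \<xi> - G (restrict \<xi> S)\<bar> \<partial>\<nu>)"
      unfolding sum_distrib_left[symmetric] e_def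
      using u integrable_cylinder[OF S(1), of G] by (subst sum_integral_atoms[OF _ T(1)]) auto
    also have "\<dots> \<le> \<epsilon>"
      using S(2) by simp
    finally show "(\<Sum>a\<in>spin_configs T. \<bar>(\<integral>\<xi>. u \<xi> * v \<xi> * atom T a \<xi> \<partial>\<nu>)
       - (\<integral>\<xi>. u \<xi> * atom T a \<xi> \<partial>\<nu>) * (\<integral>\<xi>. v \<xi> * atom T a \<xi> \<partial>\<nu>) / (\<integral>\<xi>. atom T a \<xi> \<partial>\<nu>)\<bar>) \<le> \<epsilon>"
      by (simp add: \<alpha>_def \<beta>_def n_def)
  qed
qed

text \<open>
  Up to an \<open>L\<^sup>1\<close> error, \<open>z\<close> is constant on every atom, and then the integral of its positive part over
  an atom is the positive part of its integral.
\<close>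

lemma AE_nonpos_if_atom_integrals:
  fixes z :: "('s \<Rightarrow> real) \<Rightarrow> real"
  assumes z: "integrable \<nu> z"
    and small: "\<And>\<epsilon>. \<epsilon> > 0 \<Longrightarrow> \<exists>T0. finite T0 \<and> (\<forall>T. finite T \<longrightarrow> T0 \<subseteq> T \<longrightarrow>
      (\<Sum>a\<in>spin_configs T. max 0 (\<integral>\<xi>. z \<xi> * atom T a \<xi> \<partial>\<nu>)) \<le> \<epsilon>)"
  shows "AE \<xi> in \<nu>. z \<xi> \<le> 0"
proof -
  have int: "integrable \<nu> (\<lambda>\<xi>. max 0 (z \<xi>))"
    using z by auto
  have "(\<integral>\<xi>. max 0 (z \<xi>) \<partial>\<nu>) \<le> 0 + \<epsilon>" if "\<epsilon> > 0" for \<epsilon> :: real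
  proof -
    from that have "\<epsilon> / 3 > 0"
      by simp
    obtain S G where S: "finite S" "(\<integral>\<xi>. \<bar>z \<xi> - G (restrict \<xi> S)\<bar> \<partial>\<nu>) < \<epsilon> / 3"
      using cylinder_approximable_integrable[OF z] \<open>\<epsilon> / 3 > 0\<close> unfolding cylinder_approximable_def by meson
    obtain T0 where T0: "finite T0" "\<And>T. finite T \<Longrightarrow> T0 \<subseteq> T \<Longrightarrow>
        (\<Sum>a\<in>spin_configs T. max 0 (\<integral>\<xi>. z \<xi> * atom T a \<xi> \<partial>\<nu>)) \<le> \<epsilon> / 3"
      using small[OF \<open>\<epsilon> / 3 > 0\<close>] by meson
    define T where "T = S \<union> T0"
    have T: "finite T" "S \<subseteq> T" "T0 \<subseteq> T"
      using S(1) T0(1) by (auto simp: T_def)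
    note g = integrable_cylinder[OF S(1), of G]
    have intd: "integrable \<nu> (\<lambda>\<xi>. \<bar>z \<xi> - G (restrict \<xi> S)\<bar>)"
      using z g by auto
    define e where "e = (\<lambda>a. \<integral>\<xi>. \<bar>z \<xi> - G (restrict \<xi> S)\<bar> * atom T a \<xi> \<partial>\<nu>)"
    have "(\<integral>\<xi>. max 0 (z \<xi>) * atom T a \<xi> \<partial>\<nu>) \<le> max 0 (\<integral>\<xi>. z \<xi> * atom T a \<xi> \<partial>\<nu>) + 2 * e a"
      if a: "a \<in> spin_configs T" for a
    proof -
      have inta: "integrable \<nu> (atom T a)"
        using integrable_bounded[OF atom_measurable[OF T(1) a], of 1] by (auto simp: atom_def)
      have "(\<integral>\<xi>. max 0 (z \<xi>) * atom T a \<xi> \<partial>\<nu>)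
          \<le> (\<integral>\<xi>. max 0 (G (restrict a S)) * atom T a \<xi> + \<bar>z \<xi> - G (restrict \<xi> S)\<bar> * atom T a \<xi> \<partial>\<nu>)"
      proof (rule integral_mono)
        show "max 0 (z \<xi>) * atom T a \<xi>
            \<le> max 0 (G (restrict a S)) * atom T a \<xi> + \<bar>z \<xi> - G (restrict \<xi> S)\<bar> * atom T a \<xi>" for \<xi>
        proof (cases "\<forall>i\<in>T. \<xi> i = a i")
          case True
          then have "restrict a S = restrict \<xi> S"
            using T(2) by (intro restrict_ext) auto
          then show ?thesis
            using True by (auto simp: atom_def)
        qed (auto simp: atom_def)
      qed (use integrable_times_atom[OF int T(1) a] integrable_times_atom[OF intd T(1) a] inta in auto)
      also have "\<dots> = max 0 (G (restrict a S)) * (\<integral>\<xi>. atom T a \<xi> \<partial>\<nu>) + e a"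
        unfolding e_def using integrable_times_atom[OF intd T(1) a] inta
        by (subst Bochner_Integration.integral_add) auto
      also have "max 0 (G (restrict a S)) * (\<integral>\<xi>. atom T a \<xi> \<partial>\<nu>) = max 0 (G (restrict a S) * (\<integral>\<xi>. atom T a \<xi> \<partial>\<nu>))"
        using Bochner_Integration.integral_nonneg[of \<nu> "atom T a", OF atom_bounds(1)]
        by (cases "0 \<le> G (restrict a S)") (auto simp: max_def mult_le_0_iff zero_le_mult_iff)
      also have "\<dots> \<le> max 0 (\<integral>\<xi>. z \<xi> * atom T a \<xi> \<partial>\<nu>) + e a"
        using integral_atom_cylinder_error[OF z _ _ T(1,2) a, of "\<lambda>_. 1" G] by (simp add: e_def)
      finally show ?thesis by simp
    qed
    then have "(\<Sum>a\<in>spin_configs T. \<integral>\<xi>. max 0 (z \<xi>) * atom T a \<xi> \<partial>\<nu>)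
        \<le> (\<Sum>a\<in>spin_configs T. max 0 (\<integral>\<xi>. z \<xi> * atom T a \<xi> \<partial>\<nu>) + 2 * e a)"
      by (rule sum_mono)
    also have "\<dots> = (\<Sum>a\<in>spin_configs T. max 0 (\<integral>\<xi>. z \<xi> * atom T a \<xi> \<partial>\<nu>))
        + 2 * (\<integral>\<xi>. \<bar>z \<xi> - G (restrict \<xi> S)\<bar> \<partial>\<nu>)"
      by (simp add: sum.distrib sum_distrib_left[symmetric] e_def sum_integral_atoms[OF intd T(1)])
    also have "\<dots> \<le> \<epsilon>"
      using S(2) T0(2)[OF T(1,3)] by simp
    finally show ?thesis
      by (simp add: sum_integral_atoms[OF int T(1)])
  qed
  then have "(\<integral>\<xi>. max 0 (z \<xi>) \<partial>\<nu>) \<le> 0"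
    by (rule field_le_epsilon)
  then have "(\<integral>\<xi>. max 0 (z \<xi>) \<partial>\<nu>) = 0"
    by (intro antisym Bochner_Integration.integral_nonneg) auto
  then have "AE \<xi> in \<nu>. max 0 (z \<xi>) = 0"
    using integral_nonneg_eq_0_iff_AE[OF int] by simp
  then show ?thesis
    by (rule AE_mp) (auto simp: max_def split: if_splits)
qed

text \<open>
  Inequalities between conditional expectations given finitely many spins carry over to the
  functions themselves. The integrals of \<open>u * v - w\<close> over atoms are at most the errors made by
  replacing \<open>u * v\<close> by the product of conditional expectations.
\<close>

lemma AE_product_le_if_atoms:
  fixes u v w :: "('s \<Rightarrow> real) \<Rightarrow> real"
  assumes u: "integrable \<nu> u" and v: "v \<in> borel_measurable \<nu>"
    and bound: "\<And>\<xi>. \<xi> \<in> spin_configs UNIV \<Longrightarrow> \<bar>v \<xi>\<bar> \<le> 1"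
    and w: "integrable \<nu> w" "\<And>\<xi>. \<xi> \<in> spin_configs UNIV \<Longrightarrow> 0 \<le> w \<xi>"
    and le: "\<And>T a. finite T \<Longrightarrow> a \<in> spin_configs T \<Longrightarrow>
      (\<integral>\<xi>. u \<xi> * atom T a \<xi> \<partial>\<nu>) * (\<integral>\<xi>. v \<xi> * atom T a \<xi> \<partial>\<nu>)
        \<le> (\<integral>\<xi>. w \<xi> * atom T a \<xi> \<partial>\<nu>) * (\<integral>\<xi>. atom T a \<xi> \<partial>\<nu>)"
  shows "AE \<xi> in \<nu>. u \<xi> * v \<xi> \<le> w \<xi>"
proof -
  note uv = integrable_times_bounded[OF u v bound]
  have "AE \<xi> in \<nu>. u \<xi> * v \<xi> - w \<xi> \<le> 0"
  proof (rule AE_nonpos_if_atom_integrals)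
    fix \<epsilon> :: real assume "\<epsilon> > 0"
    from sum_integral_atom_product_error[OF u v bound this]
    obtain T0 where T0: "finite T0" "\<And>T. finite T \<Longrightarrow> T0 \<subseteq> T \<Longrightarrow>
      (\<Sum>a\<in>spin_configs T. \<bar>(\<integral>\<xi>. u \<xi> * v \<xi> * atom T a \<xi> \<partial>\<nu>)
       - (\<integral>\<xi>. u \<xi> * atom T a \<xi> \<partial>\<nu>) * (\<integral>\<xi>. v \<xi> * atom T a \<xi> \<partial>\<nu>) / (\<integral>\<xi>. atom T a \<xi> \<partial>\<nu>)\<bar>) \<le> \<epsilon>"
      by meson
    show "\<exists>T0. finite T0 \<and> (\<forall>T. finite T \<longrightarrow> T0 \<subseteq> T \<longrightarrow>
      (\<Sum>a\<in>spin_configs T. max 0 (\<integral>\<xi>. (u \<xi> * v \<xi> - w \<xi>) * atom T a \<xi> \<partial>\<nu>)) \<le> \<epsilon>)"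
    proof (intro exI[of _ T0] conjI T0(1) allI impI)
      fix T assume T: "finite T" "T0 \<subseteq> T"
      show "(\<Sum>a\<in>spin_configs T. max 0 (\<integral>\<xi>. (u \<xi> * v \<xi> - w \<xi>) * atom T a \<xi> \<partial>\<nu>)) \<le> \<epsilon>"
      proof (rule order_trans[OF sum_mono T0(2)[OF T]])
        fix a assume a: "a \<in> spin_configs T"
        have n: "0 \<le> (\<integral>\<xi>. atom T a \<xi> \<partial>\<nu>)" and w': "0 \<le> (\<integral>\<xi>. w \<xi> * atom T a \<xi> \<partial>\<nu>)"
          using w(2) by (auto intro!: Bochner_Integration.integral_nonneg_AE AE_I2 simp: atom_bounds space_eq)
        have "(\<integral>\<xi>. u \<xi> * atom T a \<xi> \<partial>\<nu>) * (\<integral>\<xi>. v \<xi> * atom T a \<xi> \<partial>\<nu>) / (\<integral>\<xi>. atom T a \<xi> \<partial>\<nu>)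
            \<le> (\<integral>\<xi>. w \<xi> * atom T a \<xi> \<partial>\<nu>)"
          using le[OF T(1) a] n w' by (cases "(\<integral>\<xi>. atom T a \<xi> \<partial>\<nu>) = 0") (auto simp: divide_le_eq)
        moreover have "(\<integral>\<xi>. (u \<xi> * v \<xi> - w \<xi>) * atom T a \<xi> \<partial>\<nu>)
            = (\<integral>\<xi>. u \<xi> * v \<xi> * atom T a \<xi> \<partial>\<nu>) - (\<integral>\<xi>. w \<xi> * atom T a \<xi> \<partial>\<nu>)"
          unfolding left_diff_distrib
          by (rule Bochner_Integration.integral_diff[OF integrable_times_atom[OF uv T(1) a]
                integrable_times_atom[OF w(1) T(1) a]])
        ultimately show "max 0 (\<integral>\<xi>. (u \<xi> * v \<xi> - w \<xi>) * atom T a \<xi> \<partial>\<nu>)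
          \<le> \<bar>(\<integral>\<xi>. u \<xi> * v \<xi> * atom T a \<xi> \<partial>\<nu>)
             - (\<integral>\<xi>. u \<xi> * atom T a \<xi> \<partial>\<nu>) * (\<integral>\<xi>. v \<xi> * atom T a \<xi> \<partial>\<nu>) / (\<integral>\<xi>. atom T a \<xi> \<partial>\<nu>)\<bar>"
          by linarith
      qed
    qed
  qed (use uv w(1) in auto)
  then show ?thesis by simp
qed

text \<open>
  Positive association of two conditional expectations given the spins in \<open>T\<close>: the sum on the right is
  the integral of their product. The conditions are the lattice condition for the law of the spins in
  \<open>T\<close> and the monotonicity of the conditional expectations, both stated without division. The claim is
  the four functions theorem for the functions \<open>\<alpha>\<close>, \<open>\<beta>\<close>, \<open>\<alpha> * \<beta> / n\<close> and \<open>n\<close>, where \<open>n\<close> is the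
  probability of an atom and sums to \<open>1\<close>.
\<close>

lemma sum_atom_products_ge:
  fixes u v :: "('s \<Rightarrow> real) \<Rightarrow> real"
  assumes u: "integrable \<nu> u" "\<And>\<xi>. \<xi> \<in> spin_configs UNIV \<Longrightarrow> 0 \<le> u \<xi>"
    and v: "integrable \<nu> v" "\<And>\<xi>. \<xi> \<in> spin_configs UNIV \<Longrightarrow> 0 \<le> v \<xi>"
    and T: "finite T"
    and lattice: "\<And>a b. a \<in> spin_configs T \<Longrightarrow> b \<in> spin_configs T \<Longrightarrow>
      (\<integral>\<xi>. atom T a \<xi> \<partial>\<nu>) * (\<integral>\<xi>. atom T b \<xi> \<partial>\<nu>)
        \<le> (\<integral>\<xi>. atom T (sup a b) \<xi> \<partial>\<nu>) * (\<integral>\<xi>. atom T (inf a b) \<xi> \<partial>\<nu>)"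
    and mono_u: "\<And>a b. a \<in> spin_configs T \<Longrightarrow> b \<in> spin_configs T \<Longrightarrow> a \<le> b \<Longrightarrow>
      (\<integral>\<xi>. u \<xi> * atom T a \<xi> \<partial>\<nu>) * (\<integral>\<xi>. atom T b \<xi> \<partial>\<nu>)
        \<le> (\<integral>\<xi>. u \<xi> * atom T b \<xi> \<partial>\<nu>) * (\<integral>\<xi>. atom T a \<xi> \<partial>\<nu>)"
    and mono_v: "\<And>a b. a \<in> spin_configs T \<Longrightarrow> b \<in> spin_configs T \<Longrightarrow> a \<le> b \<Longrightarrow>
      (\<integral>\<xi>. v \<xi> * atom T a \<xi> \<partial>\<nu>) * (\<integral>\<xi>. atom T b \<xi> \<partial>\<nu>)
        \<le> (\<integral>\<xi>. v \<xi> * atom T b \<xi> \<partial>\<nu>) * (\<integral>\<xi>. atom T a \<xi> \<partial>\<nu>)"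
  shows "(\<integral>\<xi>. u \<xi> \<partial>\<nu>) * (\<integral>\<xi>. v \<xi> \<partial>\<nu>) \<le> (\<Sum>a\<in>spin_configs T.
    (\<integral>\<xi>. u \<xi> * atom T a \<xi> \<partial>\<nu>) * (\<integral>\<xi>. v \<xi> * atom T a \<xi> \<partial>\<nu>) / (\<integral>\<xi>. atom T a \<xi> \<partial>\<nu>))"
proof -
  define \<alpha> \<beta> n where "\<alpha> = (\<lambda>a. \<integral>\<xi>. u \<xi> * atom T a \<xi> \<partial>\<nu>)" and "\<beta> = (\<lambda>a. \<integral>\<xi>. v \<xi> * atom T a \<xi> \<partial>\<nu>)"
      and "n = (\<lambda>a. \<integral>\<xi>. atom T a \<xi> \<partial>\<nu>)"
  have n: "0 \<le> n a" and \<alpha>: "0 \<le> \<alpha> a" and \<beta>: "0 \<le> \<beta> a" for a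
    using u(2) v(2) unfolding \<alpha>_def \<beta>_def n_def
    by (auto intro!: Bochner_Integration.integral_nonneg_AE AE_I2 simp: atom_bounds space_eq)
  have zero: "\<alpha> a = 0 \<and> \<beta> a = 0" if "n a = 0" and a: "a \<in> spin_configs T" for a
  proof -
    have "integrable \<nu> (atom T a)"
      using integrable_bounded[OF atom_measurable[OF T a], of 1] by (auto simp: atom_def)
    then have "AE \<xi> in \<nu>. atom T a \<xi> = 0"
      using \<open>n a = 0\<close> by (simp add: n_def integral_nonneg_eq_0_iff_AE atom_bounds)
    then have "AE \<xi> in \<nu>. u \<xi> * atom T a \<xi> = 0" "AE \<xi> in \<nu>. v \<xi> * atom T a \<xi> = 0"
      by auto
    then show ?thesis
      unfolding \<alpha>_def \<beta>_def by (auto intro: integral_eq_zero_AE)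
  qed
  have "(\<Sum>a\<in>spin_configs T. \<alpha> a) * (\<Sum>a\<in>spin_configs T. \<beta> a)
      \<le> (\<Sum>a\<in>spin_configs T. \<alpha> a * \<beta> a / n a) * (\<Sum>a\<in>spin_configs T. n a)"
  proof (rule four_functions_spin_configs[OF T])
    show "0 \<le> \<alpha> a \<and> 0 \<le> \<beta> a \<and> 0 \<le> \<alpha> a * \<beta> a / n a \<and> 0 \<le> n a" for a
      using n \<alpha> \<beta> by simp
    fix a b assume a: "a \<in> spin_configs T" and b: "b \<in> spin_configs T"
    note s = spin_configs_sup_inf(1)[OF a b]
    show "\<alpha> a * \<beta> b \<le> \<alpha> (sup a b) * \<beta> (sup a b) / n (sup a b) * n (inf a b)"
    proof (cases "n a = 0 \<or> n b = 0")
      case True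
      then show ?thesis
        using zero[OF _ a] zero[OF _ b] n \<alpha> \<beta> by auto
    next
      case False
      then have pos: "n a > 0" "n b > 0"
        using n by (simp_all add: order_less_le)
      then have "0 < n a * n b"
        by simp
      also have lat: "\<dots> \<le> n (sup a b) * n (inf a b)"
        unfolding n_def by (rule lattice[OF a b])
      finally have pos': "n (sup a b) > 0"
        using n[of "sup a b"] by (auto simp: zero_less_mult_iff)
      \<comment> \<open>Conditional expectations increase from \<open>a\<close> and from \<open>b\<close> to \<open>sup a b\<close>;
        the lattice condition then trades \<open>n a * n b\<close> for \<open>n (sup a b) * n (inf a b)\<close>.\<close>
      have "\<alpha> a \<le> \<alpha> (sup a b) * n a / n (sup a b)"
        using mono_u[OF a s] pos' by (simp add: \<alpha>_def n_def pos_le_divide_eq)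
      moreover have "\<beta> b \<le> \<beta> (sup a b) * n b / n (sup a b)"
        using mono_v[OF b s] pos' by (simp add: \<beta>_def n_def pos_le_divide_eq)
      ultimately have "\<alpha> a * \<beta> b \<le> (\<alpha> (sup a b) * n a / n (sup a b)) * (\<beta> (sup a b) * n b / n (sup a b))"
        using n \<alpha> \<beta> by (intro mult_mono) auto
      also have "\<dots> = (\<alpha> (sup a b) * \<beta> (sup a b) / (n (sup a b) * n (sup a b))) * (n a * n b)"
        by simp
      also have "\<dots> \<le> (\<alpha> (sup a b) * \<beta> (sup a b) / (n (sup a b) * n (sup a b))) * (n (sup a b) * n (inf a b))"
        using lat n \<alpha> \<beta> by (intro mult_left_mono) auto
      also have "\<dots> = \<alpha> (sup a b) * \<beta> (sup a b) / n (sup a b) * n (inf a b)"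
        using pos' by simp
      finally show ?thesis .
    qed
  qed
  moreover have "(\<Sum>a\<in>spin_configs T. n a) = 1"
    using sum_integral_atoms[of "\<lambda>_. 1" T] T by (simp add: n_def prob_space)
  ultimately show ?thesis
    by (simp add: \<alpha>_def \<beta>_def n_def sum_integral_atoms[OF u(1) T] sum_integral_atoms[OF v(1) T])
qed

text \<open>
  The integral of the product of the conditional expectations given the spins in \<open>T\<close> tends to the
  integral of \<open>u * v\<close>, so a lower bound that is uniform in \<open>T\<close> survives.
\<close>

lemma integral_product_ge_if_atoms:
  fixes u v :: "('s \<Rightarrow> real) \<Rightarrow> real"
  assumes u: "integrable \<nu> u" and v: "v \<in> borel_measurable \<nu>"
    and bound: "\<And>\<xi>. \<xi> \<in> spin_configs UNIV \<Longrightarrow> \<bar>v \<xi>\<bar> \<le> 1"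
    and ge: "\<And>T. finite T \<Longrightarrow> c \<le> (\<Sum>a\<in>spin_configs T.
      (\<integral>\<xi>. u \<xi> * atom T a \<xi> \<partial>\<nu>) * (\<integral>\<xi>. v \<xi> * atom T a \<xi> \<partial>\<nu>) / (\<integral>\<xi>. atom T a \<xi> \<partial>\<nu>))"
  shows "c \<le> (\<integral>\<xi>. u \<xi> * v \<xi> \<partial>\<nu>)"
proof (rule field_le_epsilon)
  fix \<epsilon> :: real assume "\<epsilon> > 0"
  from sum_integral_atom_product_error[OF u v bound this]
  obtain T where T: "finite T" "(\<Sum>a\<in>spin_configs T. \<bar>(\<integral>\<xi>. u \<xi> * v \<xi> * atom T a \<xi> \<partial>\<nu>)
       - (\<integral>\<xi>. u \<xi> * atom T a \<xi> \<partial>\<nu>) * (\<integral>\<xi>. v \<xi> * atom T a \<xi> \<partial>\<nu>) / (\<integral>\<xi>. atom T a \<xi> \<partial>\<nu>)\<bar>) \<le> \<epsilon>"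
    by (meson order_refl)
  have "c \<le> (\<Sum>a\<in>spin_configs T.
      (\<integral>\<xi>. u \<xi> * atom T a \<xi> \<partial>\<nu>) * (\<integral>\<xi>. v \<xi> * atom T a \<xi> \<partial>\<nu>) / (\<integral>\<xi>. atom T a \<xi> \<partial>\<nu>))"
    by (rule ge[OF T(1)])
  also have "\<dots> \<le> (\<Sum>a\<in>spin_configs T. (\<integral>\<xi>. u \<xi> * v \<xi> * atom T a \<xi> \<partial>\<nu>)
       + \<bar>(\<integral>\<xi>. u \<xi> * v \<xi> * atom T a \<xi> \<partial>\<nu>)
       - (\<integral>\<xi>. u \<xi> * atom T a \<xi> \<partial>\<nu>) * (\<integral>\<xi>. v \<xi> * atom T a \<xi> \<partial>\<nu>) / (\<integral>\<xi>. atom T a \<xi> \<partial>\<nu>)\<bar>)"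
    by (rule sum_mono) linarith
  also have "\<dots> \<le> (\<integral>\<xi>. u \<xi> * v \<xi> \<partial>\<nu>) + \<epsilon>"
    unfolding sum.distrib using T sum_integral_atoms[OF integrable_times_bounded[OF u v bound] T(1)] by simp
  finally show "c \<le> (\<integral>\<xi>. u \<xi> * v \<xi> \<partial>\<nu>) + \<epsilon>" .
qed

text \<open>
  A spin is \<open>2\<close> times the indicator of the value \<open>1\<close>, minus \<open>1\<close>.
\<close>

lemma cov_spins:
  "cov \<nu> (\<lambda>X. X p) (\<lambda>X. X q)
    = 4 * (prob {\<sigma> \<in> space \<nu>. \<sigma> p = 1 \<and> \<sigma> q = 1} - prob {\<sigma> \<in> space \<nu>. \<sigma> p = 1} * prob {\<sigma> \<in> space \<nu>. \<sigma> q = 1})"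
proof -
  define P Q where "P = {\<sigma> \<in> space \<nu>. \<sigma> p = 1}" and "Q = {\<sigma> \<in> space \<nu>. \<sigma> q = 1}"
  have [measurable]: "P \<in> sets \<nu>" "Q \<in> sets \<nu>"
    unfolding P_def Q_def by measurable
  have eq: "\<sigma> p = 2 * indicator P \<sigma> - 1" "\<sigma> q = 2 * indicator Q \<sigma> - 1" if "\<sigma> \<in> space \<nu>" for \<sigma>
    using spin_configs_UNIV_cases[of \<sigma> p] spin_configs_UNIV_cases[of \<sigma> q] that
    by (auto simp: P_def Q_def space_eq[symmetric])
  have ind: "integrable \<nu> (indicator A :: _ \<Rightarrow> real)" if "A \<in> sets \<nu>" for A
    using that by (intro integrable_bounded[of _ 1]) auto
  have "(\<integral>\<sigma>. \<sigma> p * \<sigma> q \<partial>\<nu>) = (\<integral>\<sigma>. 4 * indicator (P \<inter> Q) \<sigma> - 2 * indicator P \<sigma> - 2 * indicator Q \<sigma> + 1 \<partial>\<nu>)"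
    by (rule Bochner_Integration.integral_cong) (auto simp: eq split: split_indicator)
  also have "\<dots> = 4 * prob (P \<inter> Q) - 2 * prob P - 2 * prob Q + 1"
    by (simp add: ind prob_space)
  finally have PQ: "(\<integral>\<sigma>. \<sigma> p * \<sigma> q \<partial>\<nu>) = 4 * prob (P \<inter> Q) - 2 * prob P - 2 * prob Q + 1" .
  have "(\<integral>\<sigma>. \<sigma> p \<partial>\<nu>) = (\<integral>\<sigma>. 2 * indicator P \<sigma> - 1 \<partial>\<nu>)" "(\<integral>\<sigma>. \<sigma> q \<partial>\<nu>) = (\<integral>\<sigma>. 2 * indicator Q \<sigma> - 1 \<partial>\<nu>)"
    by (auto intro!: Bochner_Integration.integral_cong simp: eq)
  then have E: "(\<integral>\<sigma>. \<sigma> p \<partial>\<nu>) = 2 * prob P - 1" "(\<integral>\<sigma>. \<sigma> q \<partial>\<nu>) = 2 * prob Q - 1"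
    by (simp_all add: ind prob_space)
  have "{\<sigma> \<in> space \<nu>. \<sigma> p = 1 \<and> \<sigma> q = 1} = P \<inter> Q"
    by (auto simp: P_def Q_def)
  then show ?thesis
    unfolding cov_def PQ E P_def[symmetric] Q_def[symmetric] by (simp add: algebra_simps)
qed

end

section \<open>Conditioning on the layer\<close>

lemma ising_state_spin_field:
  assumes "ising_state \<beta> \<mu>"
  shows "spin_field \<mu>"
  using assms
  by (rule ising_state_induct)
     (auto simp: ising_field_state_def weak_limit_def spin_field_def spin_field_axioms_def)

lemma to_layer_measurable [measurable]: "to_layer \<in> spin_space \<rightarrow>\<^sub>M spin_space"
  unfolding to_layer_def by (rule reindex_spins_measurable)

lemma spin_field_layer_law:
  assumes "spin_field \<mu>"
  shows "spin_field (layer_law \<mu>)"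
proof -
  interpret spin_field \<mu> by fact
  show ?thesis
    unfolding layer_law_def spin_field_def spin_field_axioms_def
    by (auto intro!: prob_space_distr)
qed

lemma to_layer_in_configs: "\<sigma> \<in> spin_configs UNIV \<Longrightarrow> to_layer \<sigma> \<in> spin_configs UNIV"
  using measurable_space[OF to_layer_measurable] by (auto simp: space_spin_space)

lemma layer_cond_dist_spin_field:
  assumes "layer_cond_dist \<mu> \<kappa>" and "\<xi> \<in> spin_configs UNIV"
  shows "spin_field (\<kappa> \<xi>)"
proof -
  have "\<kappa> \<in> spin_space \<rightarrow>\<^sub>M prob_algebra spin_space"
    using assms(1) by (simp add: layer_cond_dist_def)
  then have "\<kappa> \<xi> \<in> space (prob_algebra spin_space)"
    by (rule measurable_space) (simp add: space_spin_space assms(2))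
  then show ?thesis
    by (simp add: space_prob_algebra spin_field_def spin_field_axioms_def)
qed

lemma cond_prob_measurable:
  assumes "layer_cond_dist \<mu> \<kappa>" and "A \<in> sets spin_space"
  shows "(\<lambda>\<xi>. measure (\<kappa> \<xi>) A) \<in> borel_measurable spin_space"
proof -
  have "\<kappa> \<in> spin_space \<rightarrow>\<^sub>M prob_algebra spin_space"
    using assms(1) by (simp add: layer_cond_dist_def)
  then show ?thesis
    by (rule measurable_compose[OF _ measurable_measure_prob_algebra[OF assms(2)]])
qed

text \<open>
  The disintegration of \<open>\<mu>\<close> over the layer, tested against an atom.
\<close>

lemma integral_conditional_prob_atom:
  assumes "spin_field \<mu>" and \<kappa>: "layer_cond_dist \<mu> \<kappa>"
    and A [measurable]: "A \<in> sets spin_space" and T: "finite T" "a \<in> spin_configs T"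
  shows "(\<integral>\<xi>. measure (\<kappa> \<xi>) A * atom T a \<xi> \<partial>layer_law \<mu>)
    = (\<integral>\<sigma>. indicator A \<sigma> * atom T a (to_layer \<sigma>) \<partial>\<mu>)"
proof -
  interpret \<mu>: spin_field \<mu> by fact
  interpret \<nu>: spin_field "layer_law \<mu>"
    using assms(1) by (rule spin_field_layer_law)
  have [measurable]: "atom T a \<in> borel_measurable spin_space"
    using observable_atom[OF T] by (simp add: observable_def)
  define B where "B = {\<xi> \<in> space spin_space. atom T a \<xi> = 1}"
  have B [measurable]: "B \<in> sets spin_space"
    unfolding B_def by measurable
  have atom_B: "atom T a \<xi> = indicator B \<xi>" if "\<xi> \<in> spin_configs UNIV" for \<xi>
    using that by (auto simp: B_def atom_def space_spin_space)
  have meas: "(\<lambda>\<xi>. measure (\<kappa> \<xi>) A) \<in> borel_measurable spin_space"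
    by (rule cond_prob_measurable[OF \<kappa> A])
  have "integrable (layer_law \<mu>) (\<lambda>\<xi>. measure (\<kappa> \<xi>) A)"
  proof (rule \<nu>.integrable_bounded)
    show "\<bar>measure (\<kappa> \<xi>) A\<bar> \<le> 1" if "\<xi> \<in> spin_configs UNIV" for \<xi>
      using layer_cond_dist_spin_field[OF \<kappa> that] by (simp add: spin_field_def prob_space.prob_le_1)
  qed (use meas in \<open>simp add: measurable_cong_sets[OF \<nu>.sets_eq refl]\<close>)
  note int = \<nu>.integrable_times_atom[OF this T]
  let ?S = "{\<sigma> \<in> A. to_layer \<sigma> \<in> B}"
  have "A \<subseteq> space spin_space"
    using A by (rule sets.sets_into_space)
  then have "?S = A \<inter> (to_layer -` B \<inter> space spin_space)"
    by auto
  then have S: "?S \<in> sets \<mu>"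
    using measurable_sets[OF to_layer_measurable B] A by (simp add: \<mu>.sets_eq)
  have "ennreal (\<integral>\<xi>. measure (\<kappa> \<xi>) A * atom T a \<xi> \<partial>layer_law \<mu>)
      = (\<integral>\<^sup>+\<xi>. ennreal (measure (\<kappa> \<xi>) A * atom T a \<xi>) \<partial>layer_law \<mu>)"
    by (rule nn_integral_eq_integral[OF int, symmetric]) (simp add: atom_bounds)
  also have "\<dots> = (\<integral>\<^sup>+\<xi>\<in>B. emeasure (\<kappa> \<xi>) A \<partial>layer_law \<mu>)"
  proof (rule nn_integral_cong)
    fix \<xi> assume "\<xi> \<in> space (layer_law \<mu>)"
    then have \<xi>: "\<xi> \<in> spin_configs UNIV"
      by (simp add: \<nu>.space_eq)
    then interpret k: spin_field "\<kappa> \<xi>"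
      by (rule layer_cond_dist_spin_field[OF \<kappa>])
    show "ennreal (measure (\<kappa> \<xi>) A * atom T a \<xi>) = emeasure (\<kappa> \<xi>) A * indicator B \<xi>"
      by (simp add: atom_B[OF \<xi>] k.emeasure_eq_measure split: split_indicator)
  qed
  also have "\<dots> = emeasure \<mu> ?S"
    using \<kappa> A B unfolding layer_cond_dist_def by simp
  also have "\<dots> = ennreal (measure \<mu> ?S)"
    by (rule \<mu>.emeasure_eq_measure)
  finally have "(\<integral>\<xi>. measure (\<kappa> \<xi>) A * atom T a \<xi> \<partial>layer_law \<mu>) = measure \<mu> ?S"
    by (subst (asm) ennreal_inj) (auto intro!: Bochner_Integration.integral_nonneg simp: atom_bounds)
  also have "\<dots> = (\<integral>\<sigma>. indicator ?S \<sigma> \<partial>\<mu>)"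
    using S by simp
  also have "\<dots> = (\<integral>\<sigma>. indicator A \<sigma> * atom T a (to_layer \<sigma>) \<partial>\<mu>)"
    by (rule Bochner_Integration.integral_cong)
       (auto simp: \<mu>.space_eq atom_B[OF to_layer_in_configs] split: split_indicator)
  finally show ?thesis .
qed

text \<open>
  The inequality from which all correlation properties of the layer follow. For \<open>a = b\<close> it says that
  \<open>\<phi>\<close> and \<open>\<psi>\<close> are positively correlated given the layer spins in \<open>T\<close>; for \<open>\<psi> = 1\<close> and \<open>a \<le> b\<close>, that the
  conditional expectation of \<open>\<phi>\<close> is increasing; for \<open>\<phi> = \<psi> = 1\<close> it is the lattice condition for the layer
  law.
\<close>

lemma four_functions_layer:
  fixes \<mu> :: "('d::finite site \<Rightarrow> real) measure"
  assumes ff: "four_functions_measure \<mu>"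
    and \<phi>: "observable \<phi>" "\<And>\<sigma>. \<sigma> \<in> spin_configs UNIV \<Longrightarrow> 0 \<le> \<phi> \<sigma>" "mono_on (spin_configs UNIV) \<phi>"
    and \<psi>: "observable \<psi>" "\<And>\<sigma>. \<sigma> \<in> spin_configs UNIV \<Longrightarrow> 0 \<le> \<psi> \<sigma>" "mono_on (spin_configs UNIV) \<psi>"
    and T: "finite T" and a: "a \<in> spin_configs T" and b: "b \<in> spin_configs T"
  shows "(\<integral>\<sigma>. \<phi> \<sigma> * atom T a (to_layer \<sigma>) \<partial>\<mu>) * (\<integral>\<sigma>. \<psi> \<sigma> * atom T b (to_layer \<sigma>) \<partial>\<mu>)
    \<le> (\<integral>\<sigma>. \<phi> \<sigma> * \<psi> \<sigma> * atom T (sup a b) (to_layer \<sigma>) \<partial>\<mu>) * (\<integral>\<sigma>. atom T (inf a b) (to_layer \<sigma>) \<partial>\<mu>)"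
proof (rule ff[unfolded four_functions_measure_def, rule_format], intro conjI ballI)
  note lat = spin_configs_sup_inf
  have obs: "observable (\<lambda>\<sigma>. atom T c (to_layer \<sigma>))" if "c \<in> spin_configs T" for c
    unfolding to_layer_def by (rule observable_reindex[OF observable_atom[OF T that]])
  show "observable (\<lambda>\<sigma>. \<phi> \<sigma> * atom T a (to_layer \<sigma>))" "observable (\<lambda>\<sigma>. \<psi> \<sigma> * atom T b (to_layer \<sigma>))"
    "observable (\<lambda>\<sigma>. \<phi> \<sigma> * \<psi> \<sigma> * atom T (sup a b) (to_layer \<sigma>))"
    "observable (\<lambda>\<sigma>. atom T (inf a b) (to_layer \<sigma>))"
    by (intro observable_mult obs lat \<phi> \<psi> a b)+
  fix \<sigma> :: "'d site \<Rightarrow> real" assume \<sigma>: "\<sigma> \<in> spin_configs UNIV"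
  show "0 \<le> \<phi> \<sigma> * atom T a (to_layer \<sigma>)" "0 \<le> \<psi> \<sigma> * atom T b (to_layer \<sigma>)"
    "0 \<le> \<phi> \<sigma> * \<psi> \<sigma> * atom T (sup a b) (to_layer \<sigma>)" "0 \<le> atom T (inf a b) (to_layer \<sigma>)"
    using \<phi>(2)[OF \<sigma>] \<psi>(2)[OF \<sigma>] by (simp_all add: atom_bounds)
  fix \<tau> :: "'d site \<Rightarrow> real" assume \<tau>: "\<tau> \<in> spin_configs UNIV"
  have layer: "to_layer (sup \<sigma> \<tau>) = sup (to_layer \<sigma>) (to_layer \<tau>)" "to_layer (inf \<sigma> \<tau>) = inf (to_layer \<sigma>) (to_layer \<tau>)"
    by (auto simp: to_layer_def fun_eq_iff)
  have "(\<phi> \<sigma> * \<psi> \<tau>) * (atom T a (to_layer \<sigma>) * atom T b (to_layer \<tau>))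
      \<le> (\<phi> (sup \<sigma> \<tau>) * \<psi> (sup \<sigma> \<tau>)) * (atom T (sup a b) (to_layer (sup \<sigma> \<tau>)) * atom T (inf a b) (to_layer (inf \<sigma> \<tau>)))"
    unfolding layer
    using \<phi>(2)[OF \<sigma>] \<psi>(2)[OF \<tau>] \<phi>(2)[OF lat(1)[OF \<sigma> \<tau>]] \<psi>(2)[OF lat(1)[OF \<sigma> \<tau>]]
    by (intro mult_mono atom_sup_inf mono_onD[OF \<phi>(3)] mono_onD[OF \<psi>(3)] lat \<sigma> \<tau>)
       (auto simp: atom_bounds)
  then show "\<phi> \<sigma> * atom T a (to_layer \<sigma>) * (\<psi> \<tau> * atom T b (to_layer \<tau>))
      \<le> \<phi> (sup \<sigma> \<tau>) * \<psi> (sup \<sigma> \<tau>) * atom T (sup a b) (to_layer (sup \<sigma> \<tau>)) * atom T (inf a b) (to_layer (inf \<sigma> \<tau>))"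
    by (simp add: mult_ac)
qed

text \<open>
  Let \<open>u\<close>, \<open>v\<close> and \<open>w\<close> be the conditional probabilities that the spin at \<open>p\<close>, the spin at \<open>q\<close>, or both are
  \<open>1\<close>. The conditional covariance is \<open>4 * (w - u * v)\<close>. Its nonnegativity is an inequality between
  conditional expectations that can be checked on atoms. Its average is compared with the covariance
  under \<open>\<mu>\<close> by means of the positive association of \<open>u\<close> and \<open>v\<close>.
\<close>

theorem conditional_spin_covariance:
  fixes \<mu> :: "('d::finite site \<Rightarrow> real) measure"
  assumes "spin_field \<mu>" and ff: "four_functions_measure \<mu>" and \<kappa>: "layer_cond_dist \<mu> \<kappa>"
  shows "integrable (layer_law \<mu>) (\<lambda>\<xi>. cov (\<kappa> \<xi>) (\<lambda>X. X p) (\<lambda>X. X q))"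
    and "AE \<xi> in layer_law \<mu>. 0 \<le> cov (\<kappa> \<xi>) (\<lambda>X. X p) (\<lambda>X. X q)"
    and "(\<integral>\<xi>. cov (\<kappa> \<xi>) (\<lambda>X. X p) (\<lambda>X. X q) \<partial>layer_law \<mu>) \<le> cov \<mu> (\<lambda>X. X p) (\<lambda>X. X q)"
proof -
  interpret \<mu>: spin_field \<mu> by fact
  interpret \<nu>: spin_field "layer_law \<mu>"
    using assms(1) by (rule spin_field_layer_law)
  define P Q where "P = {\<sigma> \<in> space spin_space. \<sigma> p = (1::real)}" and "Q = {\<sigma> \<in> space spin_space. \<sigma> q = (1::real)}"
  define u v w where "u = (\<lambda>\<xi>. measure (\<kappa> \<xi>) P)" and "v = (\<lambda>\<xi>. measure (\<kappa> \<xi>) Q)"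
    and "w = (\<lambda>\<xi>. measure (\<kappa> \<xi>) (P \<inter> Q))"
  \<comment> \<open>Polynomial, hence continuous, forms of the indicators of \<open>P\<close> and \<open>Q\<close>.\<close>
  define \<phi> \<psi> where "\<phi> = (\<lambda>\<sigma> :: 'd site \<Rightarrow> real. (1/2) * (1 + \<sigma> p))" and "\<psi> = (\<lambda>\<sigma> :: 'd site \<Rightarrow> real. (1/2) * (1 + \<sigma> q))"
  have sets: "P \<in> sets spin_space" "Q \<in> sets spin_space" "P \<inter> Q \<in> sets spin_space"
    unfolding P_def Q_def by measurable
  have meas: "(\<lambda>\<xi>. measure (\<kappa> \<xi>) A) \<in> borel_measurable (layer_law \<mu>)" if "A \<in> sets spin_space" for A
    unfolding measurable_cong_sets[OF \<nu>.sets_eq refl]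
    by (rule cond_prob_measurable[OF \<kappa> that])
  note meas_uvw = meas[OF sets(1), folded u_def] meas[OF sets(2), folded v_def] meas[OF sets(3), folded w_def]
  have prob: "prob_space (\<kappa> \<xi>)" if "\<xi> \<in> spin_configs UNIV" for \<xi>
    using layer_cond_dist_spin_field[OF \<kappa> that] by (simp add: spin_field_def)
  have bounds: "\<bar>u \<xi>\<bar> \<le> 1" "\<bar>v \<xi>\<bar> \<le> 1" "\<bar>w \<xi>\<bar> \<le> 1" if "\<xi> \<in> spin_configs UNIV" for \<xi>
    using prob_space.prob_le_1[OF prob[OF that]] by (auto simp: u_def v_def w_def)
  have nonneg: "0 \<le> u \<xi>" "0 \<le> v \<xi>" "0 \<le> w \<xi>" for \<xi>
    by (simp_all add: u_def v_def w_def)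
  note int_u = \<nu>.integrable_bounded[OF meas_uvw(1) bounds(1)]
    and int_v = \<nu>.integrable_bounded[OF meas_uvw(2) bounds(2)]
    and int_w = \<nu>.integrable_bounded[OF meas_uvw(3) bounds(3)]
  note int_uv = \<nu>.integrable_times_bounded[OF int_u meas_uvw(2) bounds(2)]
  have cov_eq: "cov (\<kappa> \<xi>) (\<lambda>X. X p) (\<lambda>X. X q) = 4 * (w \<xi> - u \<xi> * v \<xi>)" if "\<xi> \<in> spin_configs UNIV" for \<xi>
  proof -
    interpret k: spin_field "\<kappa> \<xi>"
      by (rule layer_cond_dist_spin_field[OF \<kappa> that])
    have "P \<inter> Q = {\<sigma> \<in> space (\<kappa> \<xi>). \<sigma> p = 1 \<and> \<sigma> q = 1}" "P = {\<sigma> \<in> space (\<kappa> \<xi>). \<sigma> p = 1}" "Q = {\<sigma> \<in> space (\<kappa> \<xi>). \<sigma> q = 1}"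
      by (auto simp: P_def Q_def k.space_eq space_spin_space)
    then show ?thesis
      unfolding k.cov_spins u_def v_def w_def by simp
  qed
  have ind: "indicator P \<sigma> = \<phi> \<sigma>" "indicator Q \<sigma> = \<psi> \<sigma>" "indicator (P \<inter> Q) \<sigma> = \<phi> \<sigma> * \<psi> \<sigma>"
    if "\<sigma> \<in> spin_configs UNIV" for \<sigma>
    using spin_configs_UNIV_cases[OF that, of p] spin_configs_UNIV_cases[OF that, of q] that
    by (auto simp: P_def Q_def \<phi>_def \<psi>_def space_spin_space split: split_indicator)
  have integrals: "(\<integral>\<xi>. u \<xi> * atom T a \<xi> \<partial>layer_law \<mu>) = (\<integral>\<sigma>. \<phi> \<sigma> * atom T a (to_layer \<sigma>) \<partial>\<mu>)"
    "(\<integral>\<xi>. v \<xi> * atom T a \<xi> \<partial>layer_law \<mu>) = (\<integral>\<sigma>. \<psi> \<sigma> * atom T a (to_layer \<sigma>) \<partial>\<mu>)"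
    "(\<integral>\<xi>. w \<xi> * atom T a \<xi> \<partial>layer_law \<mu>) = (\<integral>\<sigma>. \<phi> \<sigma> * \<psi> \<sigma> * atom T a (to_layer \<sigma>) \<partial>\<mu>)"
    "(\<integral>\<xi>. atom T a \<xi> \<partial>layer_law \<mu>) = (\<integral>\<sigma>. 1 * atom T a (to_layer \<sigma>) \<partial>\<mu>)"
    if "finite T" "a \<in> spin_configs T" for T a
  proof -
    note disint = integral_conditional_prob_atom[OF assms(1) \<kappa> _ that]
    show "(\<integral>\<xi>. u \<xi> * atom T a \<xi> \<partial>layer_law \<mu>) = (\<integral>\<sigma>. \<phi> \<sigma> * atom T a (to_layer \<sigma>) \<partial>\<mu>)"
      unfolding u_def disint[OF sets(1)]
      by (rule Bochner_Integration.integral_cong) (auto simp: ind \<mu>.space_eq)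
    show "(\<integral>\<xi>. v \<xi> * atom T a \<xi> \<partial>layer_law \<mu>) = (\<integral>\<sigma>. \<psi> \<sigma> * atom T a (to_layer \<sigma>) \<partial>\<mu>)"
      unfolding v_def disint[OF sets(2)]
      by (rule Bochner_Integration.integral_cong) (auto simp: ind \<mu>.space_eq)
    show "(\<integral>\<xi>. w \<xi> * atom T a \<xi> \<partial>layer_law \<mu>) = (\<integral>\<sigma>. \<phi> \<sigma> * \<psi> \<sigma> * atom T a (to_layer \<sigma>) \<partial>\<mu>)"
      unfolding w_def disint[OF sets(3)]
      by (rule Bochner_Integration.integral_cong) (auto simp: ind \<mu>.space_eq)
    have "atom T a \<in> borel_measurable spin_space"
      using observable_atom[OF that] by (simp add: observable_def)
    then show "(\<integral>\<xi>. atom T a \<xi> \<partial>layer_law \<mu>) = (\<integral>\<sigma>. 1 * atom T a (to_layer \<sigma>) \<partial>\<mu>)"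
      unfolding layer_law_def
      by (subst integral_distr) (auto simp: measurable_cong_sets[OF \<mu>.sets_eq refl])
  qed
  have one: "observable (\<lambda>_ :: 'd site \<Rightarrow> real. 1)" "mono_on (spin_configs UNIV) (\<lambda>_ :: 'd site \<Rightarrow> real. 1 :: real)"
    by (auto simp: observable_const mono_on_def)
  have obs_affine: "observable (\<lambda>\<sigma> :: 'd site \<Rightarrow> real. (1/2) * (1 + \<sigma> x))" for x
    by (auto simp: observable_def intro!: continuous_intros continuous_on_subset[OF continuous_on_product_coordinates])
  have mono_affine: "mono_on (spin_configs UNIV) (\<lambda>\<sigma> :: 'd site \<Rightarrow> real. (1/2) * (1 + \<sigma> x))" for x
    by (rule mono_onI) (simp add: le_funD)
  have \<phi>: "observable \<phi>" "\<And>\<sigma>. \<sigma> \<in> spin_configs UNIV \<Longrightarrow> 0 \<le> \<phi> \<sigma>" "mono_on (spin_configs UNIV) \<phi>"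
    and \<psi>: "observable \<psi>" "\<And>\<sigma>. \<sigma> \<in> spin_configs UNIV \<Longrightarrow> 0 \<le> \<psi> \<sigma>" "mono_on (spin_configs UNIV) \<psi>"
    unfolding \<phi>_def \<psi>_def
    by (rule obs_affine mono_affine ind(1,2)[unfolded \<phi>_def \<psi>_def, THEN ord_le_eq_trans[OF indicator_pos_le]];
        assumption?)+
  note ff_layer = four_functions_layer[OF ff]
  have le: "(\<integral>\<xi>. u \<xi> * atom T a \<xi> \<partial>layer_law \<mu>) * (\<integral>\<xi>. v \<xi> * atom T a \<xi> \<partial>layer_law \<mu>)
      \<le> (\<integral>\<xi>. w \<xi> * atom T a \<xi> \<partial>layer_law \<mu>) * (\<integral>\<xi>. atom T a \<xi> \<partial>layer_law \<mu>)"
    if "finite T" "a \<in> spin_configs T" for T a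
    unfolding integrals[OF that] using ff_layer[OF \<phi> \<psi> that(1,2) that(2)] by simp
  have lattice: "(\<integral>\<xi>. atom T a \<xi> \<partial>layer_law \<mu>) * (\<integral>\<xi>. atom T b \<xi> \<partial>layer_law \<mu>)
      \<le> (\<integral>\<xi>. atom T (sup a b) \<xi> \<partial>layer_law \<mu>) * (\<integral>\<xi>. atom T (inf a b) \<xi> \<partial>layer_law \<mu>)"
    if "finite T" "a \<in> spin_configs T" "b \<in> spin_configs T" for T a b
    using ff_layer[OF one(1) _ one(2) one(1) _ one(2) that] that spin_configs_sup_inf[OF that(2,3)]
    by (simp add: integrals)
  have mono: "(\<integral>\<xi>. u \<xi> * atom T a \<xi> \<partial>layer_law \<mu>) * (\<integral>\<xi>. atom T b \<xi> \<partial>layer_law \<mu>)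
      \<le> (\<integral>\<xi>. u \<xi> * atom T b \<xi> \<partial>layer_law \<mu>) * (\<integral>\<xi>. atom T a \<xi> \<partial>layer_law \<mu>)"
    "(\<integral>\<xi>. v \<xi> * atom T a \<xi> \<partial>layer_law \<mu>) * (\<integral>\<xi>. atom T b \<xi> \<partial>layer_law \<mu>)
      \<le> (\<integral>\<xi>. v \<xi> * atom T b \<xi> \<partial>layer_law \<mu>) * (\<integral>\<xi>. atom T a \<xi> \<partial>layer_law \<mu>)"
    if "finite T" "a \<in> spin_configs T" "b \<in> spin_configs T" "a \<le> b" for T a b
    using ff_layer[OF \<phi> one(1) _ one(2) that(1-3)] ff_layer[OF \<psi> one(1) _ one(2) that(1-3)] that
    by (simp_all add: integrals sup_absorb2 inf_absorb1)
  have "AE \<xi> in layer_law \<mu>. u \<xi> * v \<xi> \<le> w \<xi>"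
    using le nonneg by (intro \<nu>.AE_product_le_if_atoms int_u meas_uvw(2) bounds(2) int_w) auto
  then show "AE \<xi> in layer_law \<mu>. 0 \<le> cov (\<kappa> \<xi>) (\<lambda>X. X p) (\<lambda>X. X q)"
    by (rule AE_mp) (auto simp: cov_eq \<nu>.space_eq)
  have "(\<integral>\<xi>. u \<xi> \<partial>layer_law \<mu>) * (\<integral>\<xi>. v \<xi> \<partial>layer_law \<mu>) \<le> (\<integral>\<xi>. u \<xi> * v \<xi> \<partial>layer_law \<mu>)"
    using nonneg lattice mono
    by (intro \<nu>.integral_product_ge_if_atoms int_u meas_uvw(2) bounds(2) \<nu>.sum_atom_products_ge int_v) auto
  then have product: "- (\<integral>\<xi>. u \<xi> * v \<xi> \<partial>layer_law \<mu>) \<le> - ((\<integral>\<xi>. u \<xi> \<partial>layer_law \<mu>) * (\<integral>\<xi>. v \<xi> \<partial>layer_law \<mu>))"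
    by simp
  have int_cov: "integrable (layer_law \<mu>) (\<lambda>\<xi>. 4 * (w \<xi> - u \<xi> * v \<xi>))"
    using int_w int_uv by auto
  then show "integrable (layer_law \<mu>) (\<lambda>\<xi>. cov (\<kappa> \<xi>) (\<lambda>X. X p) (\<lambda>X. X q))"
    by (rule Bochner_Integration.integrable_cong[THEN iffD1, rotated -1]) (auto simp: cov_eq \<nu>.space_eq)
  have total: "(\<integral>\<xi>. measure (\<kappa> \<xi>) A \<partial>layer_law \<mu>) = measure \<mu> A" if "A \<in> sets spin_space" for A
  proof -
    have "(\<lambda>_. undefined) \<in> spin_configs ({} :: (int ^ 'd) set)"
      by (simp add: spin_configs_def)
    \<comment> \<open>The only atom of the empty set of sites is the whole space.\<close>
    from integral_conditional_prob_atom[OF assms(1) \<kappa> that _ this] that show ?thesis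
      by (simp add: atom_def \<mu>.sets_eq)
  qed
  have "(\<integral>\<xi>. cov (\<kappa> \<xi>) (\<lambda>X. X p) (\<lambda>X. X q) \<partial>layer_law \<mu>) = (\<integral>\<xi>. 4 * (w \<xi> - u \<xi> * v \<xi>) \<partial>layer_law \<mu>)"
    by (rule Bochner_Integration.integral_cong) (auto simp: cov_eq \<nu>.space_eq)
  also have "\<dots> = 4 * ((\<integral>\<xi>. w \<xi> \<partial>layer_law \<mu>) + - (\<integral>\<xi>. u \<xi> * v \<xi> \<partial>layer_law \<mu>))"
    using int_w int_uv by simp
  also have "\<dots> \<le> 4 * ((\<integral>\<xi>. w \<xi> \<partial>layer_law \<mu>) + - ((\<integral>\<xi>. u \<xi> \<partial>layer_law \<mu>) * (\<integral>\<xi>. v \<xi> \<partial>layer_law \<mu>)))"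
    using product by simp
  also have "\<dots> = 4 * (measure \<mu> (P \<inter> Q) - measure \<mu> P * measure \<mu> Q)"
    unfolding u_def v_def w_def total[OF sets(1)] total[OF sets(2)] total[OF sets(3)] by simp
  also have "\<dots> = cov \<mu> (\<lambda>X. X p) (\<lambda>X. X q)"
  proof -
    have "P \<inter> Q = {\<sigma> \<in> space \<mu>. \<sigma> p = 1 \<and> \<sigma> q = 1}" "P = {\<sigma> \<in> space \<mu>. \<sigma> p = 1}" "Q = {\<sigma> \<in> space \<mu>. \<sigma> q = 1}"
      by (auto simp: P_def Q_def \<mu>.space_eq space_spin_space)
    then show ?thesis
      unfolding \<mu>.cov_spins by simp
  qed
  finally show "(\<integral>\<xi>. cov (\<kappa> \<xi>) (\<lambda>X. X p) (\<lambda>X. X q) \<partial>layer_law \<mu>) \<le> cov \<mu> (\<lambda>X. X p) (\<lambda>X. X q)" .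
qed

section \<open>Exceptional sites\<close>

lemma finite_card_layer_sphere:
  fixes n :: nat
  shows "finite {i :: int ^ 'd::finite. layer_norm i = int n}"
    and "card {i :: int ^ 'd::finite. layer_norm i = int n} \<le> (2 * n + 1) ^ CARD('d)"
proof -
  let ?F = "UNIV \<rightarrow>\<^sub>E {- int n..int n} :: ('d \<Rightarrow> int) set"
  have F: "finite ?F" "card ?F = (2 * n + 1) ^ CARD('d)"
    by (auto simp: finite_PiE card_PiE nat_add_distrib nat_mult_distrib)
  have sub: "{i :: int ^ 'd. layer_norm i = int n} \<subseteq> vec_lambda ` ?F"
  proof
    fix i :: "int ^ 'd" assume "i \<in> {i. layer_norm i = int n}"
    then have "\<bar>i $ k\<bar> \<le> int n" for k
      using member_le_sum[of k UNIV "\<lambda>k. \<bar>i $ k\<bar>"] by (simp add: layer_norm_def)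
    then have "($) i \<in> ?F"
      by (auto simp: PiE_iff abs_le_iff minus_le_iff)
    then show "i \<in> vec_lambda ` ?F"
      by (rule image_eqI[rotated]) simp
  qed
  show "finite {i :: int ^ 'd. layer_norm i = int n}"
    using F(1) sub by (meson finite_imageI finite_subset)
  show "card {i :: int ^ 'd. layer_norm i = int n} \<le> (2 * n + 1) ^ CARD('d)"
    using card_mono[OF finite_imageI[OF F(1)] sub] card_image_le[OF F(1), of vec_lambda] F(2) by linarith
qed

text \<open>
  Half of the exponential absorbs the polynomial: with \<open>t = m * n / (2 * d)\<close>, the factor \<open>2 * n + 1\<close>
  is at most a constant times \<open>1 + t \<le> exp t\<close>, and \<open>exp t\<close> to the power \<open>d\<close> is \<open>exp (m * n / 2)\<close>.
\<close>

lemma summable_polynomial_times_exp: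
  fixes m :: real
  assumes "m > 0" and "d > 0"
  shows "summable (\<lambda>n. real ((2 * n + 1) ^ d) * exp (- m * real n))"
proof (rule summable_comparison_test')
  define r B where "r = 4 * real d / m" and "B = 1 + r"
  have "summable (\<lambda>n. exp (- m / 2) ^ n)"
    using assms by (intro summable_geometric) simp
  then show "summable (\<lambda>n. B ^ d * exp (- m / 2) ^ n)"
    by (rule summable_mult)
  fix n :: nat
  define t where "t = m * real n / (2 * real d)"
  have "t \<ge> 0" "B \<ge> 1"
    using assms by (simp_all add: t_def r_def B_def)
  have "2 * real n + 1 = r * t + 1"
    using assms by (simp add: t_def r_def field_simps)
  also have "\<dots> \<le> B * (1 + t)"
    using \<open>t \<ge> 0\<close> \<open>B \<ge> 1\<close> by (simp add: B_def algebra_simps)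
  also have "\<dots> \<le> B * exp t"
    using \<open>B \<ge> 1\<close> exp_ge_add_one_self[of t] by (intro mult_left_mono) auto
  finally have "(2 * real n + 1) ^ d \<le> (B * exp t) ^ d"
    by (intro power_mono) auto
  also have "\<dots> = B ^ d * exp (m * real n / 2)"
    using assms by (simp add: power_mult_distrib exp_of_nat_mult[symmetric] t_def)
  finally have "(2 * real n + 1) ^ d * exp (- m * real n) \<le> B ^ d * exp (m * real n / 2) * exp (- m * real n)"
    by (intro mult_right_mono) auto
  also have "\<dots> = B ^ d * exp (- m / 2) ^ n"
    by (simp add: exp_of_nat_mult[symmetric] exp_add[symmetric] mult.assoc field_simps)
  finally show "norm (real ((2 * n + 1) ^ d) * exp (- m * real n)) \<le> B ^ d * exp (- m / 2) ^ n"
    by (simp add: add.commute)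
qed

lemma (in prob_space) exists_full_set:
  assumes "AE x in M. P x"
  shows "\<exists>K\<in>sets M. prob K = 1 \<and> (\<forall>x\<in>K. P x)"
proof -
  obtain N where N: "{x \<in> space M. \<not> P x} \<subseteq> N" "emeasure M N = 0" "N \<in> sets M"
    using assms by (rule AE_E)
  show ?thesis
  proof (intro bexI conjI ballI)
    show "prob (space M - N) = 1"
      using N(2,3) by (simp add: prob_compl emeasure_eq_measure)
  qed (use N in auto)
qed

text \<open>
  Markov's inequality in the form needed for the conditional covariances: the mean is at most \<open>C * t\<^sup>2\<close> and
  the threshold is \<open>C * t\<close>. For \<open>C = 0\<close> there is no positive threshold to divide by, but then \<open>f\<close> vanishes
  almost everywhere.
\<close>

lemma (in prob_space) prob_abs_greater_le:
  fixes f :: "'a \<Rightarrow> real"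
  assumes f: "integrable M f" "AE x in M. 0 \<le> f x" "(\<integral>x. f x \<partial>M) \<le> C * (t * t)" and "t > 0"
  shows "prob {x \<in> space M. C * t < \<bar>f x\<bar>} \<le> t"
proof -
  have "0 \<le> (\<integral>x. f x \<partial>M)"
    using f(2) by (rule Bochner_Integration.integral_nonneg_AE)
  with f(3) \<open>t > 0\<close> have "0 \<le> C"
    by (smt (verit) mult_neg_pos mult_pos_pos)
  have [measurable]: "f \<in> borel_measurable M"
    using f(1) by auto
  show ?thesis
  proof (cases "C = 0")
    case True
    then have "(\<integral>x. f x \<partial>M) = 0"
      using f(3) \<open>0 \<le> (\<integral>x. f x \<partial>M)\<close> by simp
    then have "AE x in M. f x = 0"
      using integral_nonneg_eq_0_iff_AE[OF f(1,2)] by simp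
    then have "prob {x \<in> space M. C * t < \<bar>f x\<bar>} = 0"
      unfolding True by (subst prob_eq_0) (auto elim: AE_mp)
    then show ?thesis
      using \<open>t > 0\<close> by simp
  next
    case False
    then have "C * t > 0"
      using \<open>0 \<le> C\<close> \<open>t > 0\<close> by simp
    have "AE x in M. C * t < \<bar>f x\<bar> \<longrightarrow> C * t \<le> f x"
      using f(2) by eventually_elim auto
    then have "prob {x \<in> space M. C * t < \<bar>f x\<bar>} \<le> prob {x \<in> space M. C * t \<le> f x}"
      by (intro finite_measure_mono_AE) auto
    also have "\<dots> \<le> (\<integral>x. f x \<partial>M) / (C * t)"
      by (rule integral_Markov_inequality_measure[where A = "space M"]) (use f \<open>C * t > 0\<close> in auto)
    also have "\<dots> \<le> t"
      using f(3) \<open>C * t > 0\<close> by (simp add: pos_divide_le_eq mult_ac)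
    finally show ?thesis .
  qed
qed

text \<open>
  The Borel-Cantelli lemma, applied to the spheres \<open>layer_norm i = n\<close>: the polynomial growth of their
  size is beaten by the exponential decay of the probabilities.
\<close>

lemma (in prob_space) AE_eventually_bounded_on_layer:
  fixes c :: "int ^ 'd::finite \<Rightarrow> 'a \<Rightarrow> real"
  assumes "m > 0"
    and meas: "\<And>i. c i \<in> borel_measurable M"
    and prob: "\<And>i. prob {x \<in> space M. b i < c i x} \<le> exp (- m * of_int (layer_norm i))"
  shows "AE x in M. \<exists>l :: real. \<forall>i. of_int (layer_norm i) > l \<longrightarrow> c i x \<le> b i"
proof -
  define L where "L = (\<lambda>n :: nat. {i :: int ^ 'd. layer_norm i = int n})"
  define A where "A = (\<lambda>n. \<Union>i\<in>L n. {x \<in> space M. b i < c i x})"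
  have sphere: "finite (L n)" "card (L n) \<le> (2 * n + 1) ^ CARD('d)" for n
    unfolding L_def by (rule finite_card_layer_sphere)+
  have sets [measurable]: "{x \<in> space M. b i < c i x} \<in> sets M" for i
    using meas by measurable
  then have A: "A n \<in> sets M" for n
    unfolding A_def by (intro sets.finite_UN sphere)
  have "prob (A n) \<le> real ((2 * n + 1) ^ CARD('d)) * exp (- m * real n)" for n
  proof -
    have "prob (A n) \<le> (\<Sum>i\<in>L n. prob {x \<in> space M. b i < c i x})"
      unfolding A_def by (rule finite_measure_subadditive_finite) (use sphere sets in auto)
    also have "\<dots> \<le> (\<Sum>i\<in>L n. exp (- m * real n))"
    proof (rule sum_mono)
      fix i assume "i \<in> L n"
      then have "real_of_int (layer_norm i) = real n"
        by (simp add: L_def)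
      then show "prob {x \<in> space M. b i < c i x} \<le> exp (- m * real n)"
        using prob[of i] by simp
    qed
    also have "\<dots> \<le> real ((2 * n + 1) ^ CARD('d)) * exp (- m * real n)"
      using sphere(2)[of n] by (simp del: of_nat_power add: mult_right_mono)
    finally show ?thesis .
  qed
  then have "summable (\<lambda>n. prob (A n))"
    by (intro summable_comparison_test'[OF summable_polynomial_times_exp[OF \<open>m > 0\<close>, of "CARD('d)"]])
       auto
  then have "AE x in M. \<forall>\<^sub>F n in sequentially. x \<in> space M - A n"
    by (intro borel_cantelli_AE1 A) (auto simp: emeasure_eq_measure)
  then show ?thesis
  proof eventually_elim
    case (elim x)
    then obtain N where N: "\<And>n. n \<ge> N \<Longrightarrow> x \<in> space M - A n"
      by (auto simp: eventually_sequentially)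
    show ?case
    proof (intro exI[of _ "real N"] allI impI)
      fix i :: "int ^ 'd" assume "real N < of_int (layer_norm i)"
      then have "int N < layer_norm i"
        by linarith
      then have "nat (layer_norm i) \<ge> N" "i \<in> L (nat (layer_norm i))"
        by (auto simp: L_def)
      then show "c i x \<le> b i"
        using N[of "nat (layer_norm i)"] by (auto simp: A_def)
    qed
  qed
qed

section \<open>Decay of the conditional covariances\<close>

theorem proposition4p1:
  fixes \<beta> C m :: real
    and \<mu> :: "('d::finite site \<Rightarrow> real) measure"
    and \<kappa> :: "(int ^ 'd \<Rightarrow> real) \<Rightarrow> ('d site \<Rightarrow> real) measure"
  assumes "\<beta> \<ge> 0"
    and "ising_state \<beta> \<mu>"
    and "m > 0"
    and "\<And>x. cov \<mu> (\<lambda>X. X 0) (\<lambda>X. X x) \<le> C * exp (- 2 * m * of_int (site_norm x))"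
    and "layer_cond_dist \<mu> \<kappa>"
  shows "\<exists>K0 \<in> sets (layer_law \<mu>). measure (layer_law \<mu>) K0 = 1 \<and>
    (\<forall>\<xi>\<in>K0. \<exists>l::real. \<forall>i. of_int (layer_norm i) > l \<longrightarrow>
       \<bar>cov (\<kappa> \<xi>) (\<lambda>X. X (0, 1)) (\<lambda>X. X (i, 1))\<bar> \<le> C * exp (- m * of_int (layer_norm i)))"
proof -
  have \<mu>: "spin_field \<mu>"
    using assms(2) by (rule ising_state_spin_field)
  interpret \<nu>: spin_field "layer_law \<mu>"
    using \<mu> by (rule spin_field_layer_law)
  define c where "c = (\<lambda>(i :: int ^ 'd) \<xi>. cov (\<kappa> \<xi>) (\<lambda>X. X (0, 1)) (\<lambda>X. X (i, 1)))"
  note cov = conditional_spin_covariance[OF \<mu> four_functions_ising_state[OF assms(1,2)] assms(5)]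
  have prob: "\<nu>.prob {\<xi> \<in> space (layer_law \<mu>). C * exp (- m * of_int (layer_norm i)) < \<bar>c i \<xi>\<bar>}
      \<le> exp (- m * of_int (layer_norm i))" for i
  proof (rule \<nu>.prob_abs_greater_le)
    show "integrable (layer_law \<mu>) (c i)" "AE \<xi> in layer_law \<mu>. 0 \<le> c i \<xi>"
      unfolding c_def by (rule cov)+
    have "(\<integral>\<xi>. c i \<xi> \<partial>layer_law \<mu>) \<le> cov \<mu> (\<lambda>X. X (0, 1)) (\<lambda>X. X (i, 1))"
      unfolding c_def by (rule cov)
    also have "\<dots> = cov \<mu> (\<lambda>X. X 0) (\<lambda>X. X (i, 0))"
      using translation_invariant_cov[OF translation_invariant_ising_state[OF assms(2)], of 0 "(0, 1)" "(i, 0)"]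
      by simp
    also have "\<dots> \<le> C * exp (- 2 * m * of_int (site_norm (i, 0)))"
      by (rule assms(4))
    finally show "(\<integral>\<xi>. c i \<xi> \<partial>layer_law \<mu>)
        \<le> C * (exp (- m * of_int (layer_norm i)) * exp (- m * of_int (layer_norm i)))"
      by (simp add: site_norm_def exp_add[symmetric] mult.assoc)
  qed simp
  have "AE \<xi> in layer_law \<mu>. \<exists>l::real. \<forall>i. of_int (layer_norm i) > l \<longrightarrow>
      \<bar>c i \<xi>\<bar> \<le> C * exp (- m * of_int (layer_norm i))"
    by (rule \<nu>.AE_eventually_bounded_on_layer[OF \<open>m > 0\<close> _ prob])
       (use cov(1) in \<open>auto simp: c_def intro!: borel_measurable_abs\<close>)
  then show ?thesis
    unfolding c_def by (rule \<nu>.exists_full_set)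
qed

end
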